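(* Let $\mathcal{C}$ be a weakly idempotent complete additive category. Then the class of all stable exact sequences in $\mathcal{C}$ defines an exact structure on $\mathcal{C}$. Moreover, this is the maximal exact structure on $\mathcal{C}$; that is, for every exact structure $\mathcal{E}$ on $\mathcal{C}$, every short exact sequence belonging to $\mathcal{E}$ is a stable exact sequence.
   Context: An additive category is called weakly idempotent complete if every retraction (split epimorphism) has a kernel; equivalently, every section (split monomorphism) has a cokernel. A morphism is called a cokernel (respectively, a kernel) if it is a cokernel (respectively, a kernel) of some morphism. A short exact sequence in an additive category is a kernel-cokernel pair, i.e. a pair of composable morphisms $A\stackrel{i}\to B\stackrel{d}\to C$ such that $i$ is a kernel of $d$ and $d$ is a cokernel of $i$. A cokernel $d:B\to C$ is called a semi-stable cokernel if for every morphism $h:C'\to C$ the pullback of $d$ along $h$ exists and is again a cokernel, i.e. there is a pullback square with morphisms $d':B'\to C'$, $g:B'\to B$, $dg=hd'$, in which $d'$ is a cokernel. Dually, a kernel $i:A\to B$ is called a semi-stable kernel if for every morphism $f:A\to A'$ the pushout of $i$ along $f$ exists and is again a kernel, i.e. there is a pushout square with morphisms $i':A'\to B'$, $g:B\to B'$, $gi=i'f$, in which $i'$ is a kernel. A short exact sequence $A\stackrel{i}\to B\stackrel{d}\to C$ is called stable if $i$ is a semi-stable kernel and $d$ is a semi-stable cokernel. An exact structure on an additive category $\mathcal{C}$ (in the sense of Quillen, refined by Keller) is a distinguished class $\mathcal{E}$ of short exact sequences in $\mathcal{C}$, whose members are called conflations, satisfying the following axioms, where the kernels $i$ and cokernels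 $d$ appearing in conflations $A\stackrel{i}\to B\stackrel{d}\to C$ are called inflations and deflations respectively: $[E0]$ The identity morphism $1_0:0\to 0$ is a deflation. $[E1]$ The composition of two deflations is again a deflation. $[E2]$ The pullback of a deflation along an arbitrary morphism exists and is again a deflation. $[E2^{\rm op}]$ The pushout of an inflation along an arbitrary morphism exists and is again an inflation. *)

theory Defs
  imports "HOL-Algebra.Group"
begin

text \<open>
  Categories are given by a set of objects and a set of arrows with a source and a target;
  \<open>g \<cdot> f\<close> is the composite of \<open>f\<close> followed by \<open>g\<close>. All operations are only meaningful
  on objects, on arrows, on composable pairs of arrows (\<open>Comp\<close>) and on parallel pairs (\<open>Add\<close>).
  \<open>Zero A B\<close> is the neutral element of the group of morphisms from \<open>A\<close> to \<open>B\<close>.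
\<close>

record ('o, 'm) preadd_cat =
  Obj :: "'o set"
  Arr :: "'m set"
  Dom :: "'m \<Rightarrow> 'o"
  Cod :: "'m \<Rightarrow> 'o"
  Id :: "'o \<Rightarrow> 'm"
  Comp :: "'m \<Rightarrow> 'm \<Rightarrow> 'm" (infixl "\<cdot>\<index>" 70)
  Add :: "'m \<Rightarrow> 'm \<Rightarrow> 'm"
  Zero :: "'o \<Rightarrow> 'o \<Rightarrow> 'm"

definition Mor :: "('o, 'm, 'z) preadd_cat_scheme \<Rightarrow> 'o \<Rightarrow> 'o \<Rightarrow> 'm set" where
  "Mor C A B = {f \<in> Arr C. Dom C f = A \<and> Cod C f = B}"

locale category =
  fixes C :: "('o, 'm, 'z) preadd_cat_scheme" (structure)
  assumes Dom_Obj: "f \<in> Arr C \<Longrightarrow> Dom C f \<in> Obj C"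
    and Cod_Obj: "f \<in> Arr C \<Longrightarrow> Cod C f \<in> Obj C"
    and Id_Mor: "A \<in> Obj C \<Longrightarrow> Id C A \<in> Mor C A A"
    and Comp_Mor: "f \<in> Mor C X Y \<Longrightarrow> g \<in> Mor C Y Z \<Longrightarrow> g \<cdot> f \<in> Mor C X Z"
    and Comp_Id: "f \<in> Mor C X Y \<Longrightarrow> f \<cdot> Id C X = f"
    and Id_Comp: "f \<in> Mor C X Y \<Longrightarrow> Id C Y \<cdot> f = f"
    and Comp_assoc: "f \<in> Mor C W X \<Longrightarrow> g \<in> Mor C X Y \<Longrightarrow> h \<in> Mor C Y Z
      \<Longrightarrow> (h \<cdot> g) \<cdot> f = h \<cdot> (g \<cdot> f)"

definition is_zero_object :: "('o, 'm, 'z) preadd_cat_scheme \<Rightarrow> 'o \<Rightarrow> bool" where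
  "is_zero_object C Z \<longleftrightarrow> Z \<in> Obj C \<and>
     (\<forall>A \<in> Obj C. (\<exists>!f. f \<in> Mor C A Z) \<and> (\<exists>!f. f \<in> Mor C Z A))"

definition is_biproduct ::
  "('o, 'm, 'z) preadd_cat_scheme \<Rightarrow> 'o \<Rightarrow> 'o \<Rightarrow> 'o \<Rightarrow> 'm \<Rightarrow> 'm \<Rightarrow> 'm \<Rightarrow> 'm \<Rightarrow> bool" where
  "is_biproduct C A B S i\<^sub>A i\<^sub>B p\<^sub>A p\<^sub>B \<longleftrightarrow>
     i\<^sub>A \<in> Mor C A S \<and> i\<^sub>B \<in> Mor C B S \<and> p\<^sub>A \<in> Mor C S A \<and> p\<^sub>B \<in> Mor C S B \<and>
     p\<^sub>A \<cdot>\<^bsub>C\<^esub> i\<^sub>A = Id C A \<and> p\<^sub>B \<cdot>\<^bsub>C\<^esub> i\<^sub>B = Id C B \<and>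
     p\<^sub>A \<cdot>\<^bsub>C\<^esub> i\<^sub>B = Zero C B A \<and> p\<^sub>B \<cdot>\<^bsub>C\<^esub> i\<^sub>A = Zero C A B \<and>
     Add C (i\<^sub>A \<cdot>\<^bsub>C\<^esub> p\<^sub>A) (i\<^sub>B \<cdot>\<^bsub>C\<^esub> p\<^sub>B) = Id C S"

locale additive_category = category +
  assumes Mor_group: "A \<in> Obj C \<Longrightarrow> B \<in> Obj C \<Longrightarrow>
      comm_group \<lparr>carrier = Mor C A B, monoid.mult = Add C, one = Zero C A B\<rparr>"
    and Comp_Add: "f \<in> Mor C X Y \<Longrightarrow> f' \<in> Mor C X Y \<Longrightarrow> g \<in> Mor C Y Z
      \<Longrightarrow> g \<cdot> Add C f f' = Add C (g \<cdot> f) (g \<cdot> f')"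
    and Add_Comp: "f \<in> Mor C X Y \<Longrightarrow> g \<in> Mor C Y Z \<Longrightarrow> g' \<in> Mor C Y Z
      \<Longrightarrow> Add C g g' \<cdot> f = Add C (g \<cdot> f) (g' \<cdot> f)"
    and ex_zero_object: "\<exists>Z. is_zero_object C Z"
    and ex_biproduct: "A \<in> Obj C \<Longrightarrow> B \<in> Obj C
      \<Longrightarrow> \<exists>S i\<^sub>A i\<^sub>B p\<^sub>A p\<^sub>B. is_biproduct C A B S i\<^sub>A i\<^sub>B p\<^sub>A p\<^sub>B"

definition is_kernel_of :: "('o, 'm, 'z) preadd_cat_scheme \<Rightarrow> 'm \<Rightarrow> 'm \<Rightarrow> bool" where
  "is_kernel_of C i d \<longleftrightarrow>
     i \<in> Arr C \<and> d \<in> Arr C \<and> Cod C i = Dom C d \<and>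
     d \<cdot>\<^bsub>C\<^esub> i = Zero C (Dom C i) (Cod C d) \<and>
     (\<forall>h \<in> Arr C. Cod C h = Dom C d \<and> d \<cdot>\<^bsub>C\<^esub> h = Zero C (Dom C h) (Cod C d) \<longrightarrow>
        (\<exists>!u. u \<in> Mor C (Dom C h) (Dom C i) \<and> i \<cdot>\<^bsub>C\<^esub> u = h))"

definition is_cokernel_of :: "('o, 'm, 'z) preadd_cat_scheme \<Rightarrow> 'm \<Rightarrow> 'm \<Rightarrow> bool" where
  "is_cokernel_of C d i \<longleftrightarrow>
     d \<in> Arr C \<and> i \<in> Arr C \<and> Cod C i = Dom C d \<and>
     d \<cdot>\<^bsub>C\<^esub> i = Zero C (Dom C i) (Cod C d) \<and>
     (\<forall>h \<in> Arr C. Dom C h = Cod C i \<and> h \<cdot>\<^bsub>C\<^esub> i = Zero C (Dom C i) (Cod C h) \<longrightarrow>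
        (\<exists>!u. u \<in> Mor C (Cod C d) (Cod C h) \<and> u \<cdot>\<^bsub>C\<^esub> d = h))"

definition is_kernel :: "('o, 'm, 'z) preadd_cat_scheme \<Rightarrow> 'm \<Rightarrow> bool" where
  "is_kernel C i \<longleftrightarrow> (\<exists>d. is_kernel_of C i d)"

definition is_cokernel :: "('o, 'm, 'z) preadd_cat_scheme \<Rightarrow> 'm \<Rightarrow> bool" where
  "is_cokernel C d \<longleftrightarrow> (\<exists>i. is_cokernel_of C d i)"

definition is_retraction :: "('o, 'm, 'z) preadd_cat_scheme \<Rightarrow> 'm \<Rightarrow> bool" where
  "is_retraction C r \<longleftrightarrow> r \<in> Arr C \<and>
     (\<exists>s \<in> Mor C (Cod C r) (Dom C r). r \<cdot>\<^bsub>C\<^esub> s = Id C (Cod C r))"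

definition weakly_idempotent_complete :: "('o, 'm, 'z) preadd_cat_scheme \<Rightarrow> bool" where
  "weakly_idempotent_complete C \<longleftrightarrow>
     (\<forall>r. is_retraction C r \<longrightarrow> (\<exists>i. is_kernel_of C i r))"

text \<open>
  \<open>is_pullback C d h d' g\<close>: the square \<open>d \<cdot> g = h \<cdot> d'\<close> exhibits \<open>d'\<close> as a pullback of \<open>d\<close> along \<open>h\<close>.
  \<open>is_pushout C i f i' g\<close>: the square \<open>g \<cdot> i = i' \<cdot> f\<close> exhibits \<open>i'\<close> as a pushout of \<open>i\<close> along \<open>f\<close>.
\<close>

definition is_pullback ::
  "('o, 'm, 'z) preadd_cat_scheme \<Rightarrow> 'm \<Rightarrow> 'm \<Rightarrow> 'm \<Rightarrow> 'm \<Rightarrow> bool" where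
  "is_pullback C d h d' g \<longleftrightarrow>
     d \<in> Arr C \<and> h \<in> Arr C \<and> Cod C d = Cod C h \<and>
     d' \<in> Arr C \<and> g \<in> Arr C \<and> Dom C d' = Dom C g \<and>
     Cod C d' = Dom C h \<and> Cod C g = Dom C d \<and>
     d \<cdot>\<^bsub>C\<^esub> g = h \<cdot>\<^bsub>C\<^esub> d' \<and>
     (\<forall>x \<in> Arr C. \<forall>y \<in> Arr C.
        Dom C x = Dom C y \<and> Cod C x = Dom C h \<and> Cod C y = Dom C d \<and>
        d \<cdot>\<^bsub>C\<^esub> y = h \<cdot>\<^bsub>C\<^esub> x \<longrightarrow>
        (\<exists>!u. u \<in> Mor C (Dom C x) (Dom C d') \<and> d' \<cdot>\<^bsub>C\<^esub> u = x \<and> g \<cdot>\<^bsub>C\<^esub> u = y))"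

definition is_pushout ::
  "('o, 'm, 'z) preadd_cat_scheme \<Rightarrow> 'm \<Rightarrow> 'm \<Rightarrow> 'm \<Rightarrow> 'm \<Rightarrow> bool" where
  "is_pushout C i f i' g \<longleftrightarrow>
     i \<in> Arr C \<and> f \<in> Arr C \<and> Dom C i = Dom C f \<and>
     i' \<in> Arr C \<and> g \<in> Arr C \<and> Cod C i' = Cod C g \<and>
     Dom C i' = Cod C f \<and> Dom C g = Cod C i \<and>
     g \<cdot>\<^bsub>C\<^esub> i = i' \<cdot>\<^bsub>C\<^esub> f \<and>
     (\<forall>x \<in> Arr C. \<forall>y \<in> Arr C.
        Cod C x = Cod C y \<and> Dom C x = Cod C f \<and> Dom C y = Cod C i \<and>
        y \<cdot>\<^bsub>C\<^esub> i = x \<cdot>\<^bsub>C\<^esub> f \<longrightarrow>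
        (\<exists>!u. u \<in> Mor C (Cod C i') (Cod C x) \<and> u \<cdot>\<^bsub>C\<^esub> i' = x \<and> u \<cdot>\<^bsub>C\<^esub> g = y))"

definition semi_stable_cokernel :: "('o, 'm, 'z) preadd_cat_scheme \<Rightarrow> 'm \<Rightarrow> bool" where
  "semi_stable_cokernel C d \<longleftrightarrow> is_cokernel C d \<and>
     (\<forall>h \<in> Arr C. Cod C h = Cod C d \<longrightarrow>
        (\<exists>d' g. is_pullback C d h d' g \<and> is_cokernel C d'))"

definition semi_stable_kernel :: "('o, 'm, 'z) preadd_cat_scheme \<Rightarrow> 'm \<Rightarrow> bool" where
  "semi_stable_kernel C i \<longleftrightarrow> is_kernel C i \<and>
     (\<forall>f \<in> Arr C. Dom C f = Dom C i \<longrightarrow>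
        (\<exists>i' g. is_pushout C i f i' g \<and> is_kernel C i'))"

definition short_exact_sequences :: "('o, 'm, 'z) preadd_cat_scheme \<Rightarrow> ('m \<times> 'm) set" where
  "short_exact_sequences C = {(i, d). is_kernel_of C i d \<and> is_cokernel_of C d i}"

definition stable_exact_sequences :: "('o, 'm, 'z) preadd_cat_scheme \<Rightarrow> ('m \<times> 'm) set" where
  "stable_exact_sequences C =
     {(i, d) \<in> short_exact_sequences C. semi_stable_kernel C i \<and> semi_stable_cokernel C d}"

definition inflation :: "('m \<times> 'm) set \<Rightarrow> 'm \<Rightarrow> bool" where
  "inflation E i \<longleftrightarrow> (\<exists>d. (i, d) \<in> E)"

definition deflation :: "('m \<times> 'm) set \<Rightarrow> 'm \<Rightarrow> bool" where
  "deflation E d \<longleftrightarrow> (\<exists>i. (i, d) \<in> E)"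

text \<open>
  Pullbacks and pushouts are determined only up to isomorphism, so E2 and its dual require that
  one exists and that every choice of it is again a deflation (an inflation). Taking the pullback
  along an identity, this makes the deflations, and dually the inflations, invariant under isomorphism.
\<close>

locale exact_structure =
  fixes C :: "('o, 'm, 'z) preadd_cat_scheme" (structure)
    and E :: "('m \<times> 'm) set"
  assumes conflations: "E \<subseteq> short_exact_sequences C"
    and E0: "is_zero_object C Z \<Longrightarrow> deflation E (Id C Z)"
    and E1: "deflation E d \<Longrightarrow> deflation E d' \<Longrightarrow> Cod C d = Dom C d' \<Longrightarrow> deflation E (d' \<cdot> d)"
    and E2_ex: "deflation E d \<Longrightarrow> h \<in> Arr C \<Longrightarrow> Cod C h = Cod C d
      \<Longrightarrow> \<exists>d' g. is_pullback C d h d' g"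
    and E2: "deflation E d \<Longrightarrow> is_pullback C d h d' g \<Longrightarrow> deflation E d'"
    and E2op_ex: "inflation E i \<Longrightarrow> f \<in> Arr C \<Longrightarrow> Dom C f = Dom C i
      \<Longrightarrow> \<exists>i' g. is_pushout C i f i' g"
    and E2op: "inflation E i \<Longrightarrow> is_pushout C i f i' g \<Longrightarrow> inflation E i'"

end

theory Submission imports Defs begin

text \<open>
  Write \<open>ssc\<close> for semi-stable cokernel and \<open>ssk\<close> for semi-stable kernel. Pullback squares can be pasted,
  so in any additive category the class of \<open>ssc\<close>s is closed under pullback
  (\<open>semi_stable_cokernel_pullback\<close>) and under composition (\<open>semi_stable_cokernel_comp\<close>); dually
  for \<open>ssk\<close>s. This settles one half of each axiom. What is left is the other half of a stable sequence: the
  kernels of the new deflations must again be \<open>ssk\<close>s. Here weak idempotent completeness enters, through the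
  cancellation property that \<open>f\<close> is an \<open>ssk\<close> whenever \<open>g \<cdot> f\<close> is one
  (\<open>semi_stable_kernel_left_factor\<close>, the dual of \<open>semi_stable_cokernel_right_factor\<close>).

  For pullbacks this is immediate: if \<open>i\<close> is the kernel of \<open>d\<close> and \<open>d'\<close> is the pullback of \<open>d\<close>, with
  \<open>g\<close> the map on top, then \<open>d'\<close> has a kernel \<open>i'\<close> with \<open>g \<cdot> i' = i\<close>, and \<open>g\<close> can be cancelled.

  For composites, let \<open>p : A \<rightarrow> B\<close> and \<open>q : B \<rightarrow> D\<close> be deflations with kernels \<open>i : I \<rightarrow> A\<close> and
  \<open>j : J \<rightarrow> B\<close>. The pullback of \<open>p\<close> along \<open>j\<close> gives \<open>r : K \<rightarrow> J\<close> and the kernel \<open>m : K \<rightarrow> A\<close> of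
  \<open>q \<cdot> p\<close>, with \<open>p \<cdot> m = j \<cdot> r\<close>. The kernel \<open>a : I \<rightarrow> K\<close> of \<open>r\<close> satisfies \<open>m \<cdot> a = i\<close>, hence
  \<open>(m, r) : K \<rightarrow> A \<oplus> J\<close> is the pushout of \<open>i\<close> along \<open>a\<close> and so an \<open>ssk\<close>
  (\<open>semi_stable_kernel_pairing\<close>). Also \<open>1 \<oplus> j : A \<oplus> J \<rightarrow> A \<oplus> B\<close> is an \<open>ssk\<close>, being a pushout
  of \<open>j\<close> (\<open>semi_stable_kernel_direct_sum\<close>). Their composite is \<open>(m, j \<cdot> r) = (m, p \<cdot> m) = (1, p) \<cdot> m\<close>,
  and cancelling \<open>(1, p)\<close> shows that \<open>m\<close> is an \<open>ssk\<close>.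

  The statements about inflations follow by passing to the opposite category, which is again additive and
  weakly idempotent complete. Maximality is a direct consequence of the pullback and pushout axioms, since
  every deflation is a cokernel and every inflation is a kernel.
\<close>

section \<open>Arrows, kernels and pullbacks\<close>

context category
begin

lemma Mor_iff: "f \<in> Mor C A B \<longleftrightarrow> f \<in> Arr C \<and> Dom C f = A \<and> Cod C f = B"
  by (simp add: Mor_def)

lemma Mor_Obj: "f \<in> Mor C A B \<Longrightarrow> A \<in> Obj C" "f \<in> Mor C A B \<Longrightarrow> B \<in> Obj C"
  using Dom_Obj Cod_Obj by (auto simp: Mor_iff)

lemma Comp_typing [simp]:
  assumes "f \<in> Arr C" "g \<in> Arr C" "Dom C g = Cod C f"
  shows "g \<cdot> f \<in> Arr C" "Dom C (g \<cdot> f) = Dom C f" "Cod C (g \<cdot> f) = Cod C g"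
  using assms Comp_Mor[of f "Dom C f" "Cod C f" g "Cod C g"] by (auto simp: Mor_iff)

lemma comp_reduce:
  assumes "g \<cdot> f = e" "f \<in> Mor C X Y" "g \<in> Mor C Y Z" "x \<in> Mor C W X"
  shows "g \<cdot> (f \<cdot> x) = e \<cdot> x"
  using Comp_assoc[OF assms(4,2,3)] assms(1) by simp

lemma comp_square:
  assumes "g \<cdot> f = k \<cdot> h" "f \<in> Mor C X Y" "g \<in> Mor C Y Z" "h \<in> Mor C X Y'" "k \<in> Mor C Y' Z"
    and "x \<in> Mor C W X"
  shows "g \<cdot> (f \<cdot> x) = k \<cdot> (h \<cdot> x)"
  using comp_reduce[OF assms(1-3,6)] Comp_assoc[OF assms(6,4,5)] by simp

lemma is_kernel_of_typing:
  assumes "is_kernel_of C i d"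
  shows "\<exists>A B D. i \<in> Mor C A B \<and> d \<in> Mor C B D \<and> d \<cdot> i = Zero C A D"
  using assms by (auto simp: is_kernel_of_def Mor_iff)

lemma is_kernel_of_intro:
  assumes "i \<in> Mor C A B" "d \<in> Mor C B D" "d \<cdot> i = Zero C A D"
    and "\<And>X h. h \<in> Mor C X B \<Longrightarrow> d \<cdot> h = Zero C X D \<Longrightarrow> \<exists>u \<in> Mor C X A. i \<cdot> u = h"
    and "\<And>X u v. u \<in> Mor C X A \<Longrightarrow> v \<in> Mor C X A \<Longrightarrow> i \<cdot> u = i \<cdot> v \<Longrightarrow> u = v"
  shows "is_kernel_of C i d"
  unfolding is_kernel_of_def
proof (intro conjI ballI impI)
  fix h assume h: "h \<in> Arr C" "Cod C h = Dom C d \<and> d \<cdot> h = Zero C (Dom C h) (Cod C d)"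
  then obtain u where u: "u \<in> Mor C (Dom C h) A" "i \<cdot> u = h"
    using assms(2) assms(4)[of h "Dom C h"] by (auto simp: Mor_iff)
  have eq: "Dom C i = A" using assms(1) by (simp add: Mor_iff)
  show "\<exists>!u. u \<in> Mor C (Dom C h) (Dom C i) \<and> i \<cdot> u = h"
  proof (rule ex1I[of _ u])
    fix v assume "v \<in> Mor C (Dom C h) (Dom C i) \<and> i \<cdot> v = h"
    then show "v = u" using u assms(5)[of v "Dom C h" u] unfolding eq by simp
  qed (use u eq in simp)
qed (use assms(1-3) in \<open>auto simp: Mor_iff\<close>)

lemma kernel_factor:
  assumes "is_kernel_of C i d" "i \<in> Mor C A B" "d \<in> Mor C B D"
    and "h \<in> Mor C X B" "d \<cdot> h = Zero C X D"
  shows "\<exists>u \<in> Mor C X A. i \<cdot> u = h"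
proof -
  have "h \<in> Arr C" "Cod C h = Dom C d" "d \<cdot> h = Zero C (Dom C h) (Cod C d)"
    using assms by (auto simp: Mor_iff)
  then have "\<exists>!u. u \<in> Mor C (Dom C h) (Dom C i) \<and> i \<cdot> u = h"
    using assms(1) unfolding is_kernel_of_def by blast
  moreover have "Dom C h = X" "Dom C i = A" using assms(2,4) by (auto simp: Mor_iff)
  ultimately show ?thesis by auto
qed

lemma is_cokernel_of_typing:
  assumes "is_cokernel_of C d i"
  shows "\<exists>A B D. i \<in> Mor C A B \<and> d \<in> Mor C B D \<and> d \<cdot> i = Zero C A D"
  using assms by (auto simp: is_cokernel_of_def Mor_iff)

lemma is_cokernel_of_intro:
  assumes "i \<in> Mor C A B" "d \<in> Mor C B D" "d \<cdot> i = Zero C A D"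
    and "\<And>X h. h \<in> Mor C B X \<Longrightarrow> h \<cdot> i = Zero C A X \<Longrightarrow> \<exists>u \<in> Mor C D X. u \<cdot> d = h"
    and "\<And>X u v. u \<in> Mor C D X \<Longrightarrow> v \<in> Mor C D X \<Longrightarrow> u \<cdot> d = v \<cdot> d \<Longrightarrow> u = v"
  shows "is_cokernel_of C d i"
  unfolding is_cokernel_of_def
proof (intro conjI ballI impI)
  fix h assume h: "h \<in> Arr C" "Dom C h = Cod C i \<and> h \<cdot> i = Zero C (Dom C i) (Cod C h)"
  then obtain u where u: "u \<in> Mor C D (Cod C h)" "u \<cdot> d = h"
    using assms(1) assms(4)[of h "Cod C h"] by (auto simp: Mor_iff)
  have eq: "Cod C d = D" using assms(2) by (simp add: Mor_iff)
  show "\<exists>!u. u \<in> Mor C (Cod C d) (Cod C h) \<and> u \<cdot> d = h"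
  proof (rule ex1I[of _ u])
    fix v assume "v \<in> Mor C (Cod C d) (Cod C h) \<and> v \<cdot> d = h"
    then show "v = u" using u assms(5)[of v "Cod C h" u] unfolding eq by simp
  qed (use u eq in simp)
qed (use assms(1-3) in \<open>auto simp: Mor_iff\<close>)

lemma cokernel_factor:
  assumes "is_cokernel_of C d i" "i \<in> Mor C A B" "d \<in> Mor C B D"
    and "h \<in> Mor C B X" "h \<cdot> i = Zero C A X"
  shows "\<exists>u \<in> Mor C D X. u \<cdot> d = h"
proof -
  have "h \<in> Arr C" "Dom C h = Cod C i" "h \<cdot> i = Zero C (Dom C i) (Cod C h)"
    using assms by (auto simp: Mor_iff)
  then have "\<exists>!u. u \<in> Mor C (Cod C d) (Cod C h) \<and> u \<cdot> d = h"
    using assms(1) unfolding is_cokernel_of_def by blast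
  moreover have "Cod C h = X" "Cod C d = D" using assms(3,4) by (auto simp: Mor_iff)
  ultimately show ?thesis by auto
qed

lemma is_pullback_typing:
  assumes "is_pullback C d h d' g"
  shows "\<exists>P B X D. d \<in> Mor C B D \<and> h \<in> Mor C X D \<and> d' \<in> Mor C P X \<and> g \<in> Mor C P B \<and>
    d \<cdot> g = h \<cdot> d'"
  using assms by (auto simp: is_pullback_def Mor_iff)

lemma is_pullback_intro:
  assumes "d \<in> Mor C B D" "h \<in> Mor C X D" "d' \<in> Mor C P X" "g \<in> Mor C P B" "d \<cdot> g = h \<cdot> d'"
    and "\<And>Y x y. x \<in> Mor C Y X \<Longrightarrow> y \<in> Mor C Y B \<Longrightarrow> d \<cdot> y = h \<cdot> x
      \<Longrightarrow> \<exists>u \<in> Mor C Y P. d' \<cdot> u = x \<and> g \<cdot> u = y"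
    and "\<And>Y u v. u \<in> Mor C Y P \<Longrightarrow> v \<in> Mor C Y P \<Longrightarrow> d' \<cdot> u = d' \<cdot> v \<Longrightarrow> g \<cdot> u = g \<cdot> v \<Longrightarrow> u = v"
  shows "is_pullback C d h d' g"
  unfolding is_pullback_def
proof (intro conjI ballI impI)
  fix x y assume "x \<in> Arr C" "y \<in> Arr C"
    "Dom C x = Dom C y \<and> Cod C x = Dom C h \<and> Cod C y = Dom C d \<and> d \<cdot> y = h \<cdot> x"
  then obtain u where u: "u \<in> Mor C (Dom C x) P" "d' \<cdot> u = x" "g \<cdot> u = y"
    using assms(1,2) assms(6)[of x "Dom C x" y] by (auto simp: Mor_iff)
  have eq: "Dom C d' = P" using assms(3) by (simp add: Mor_iff)
  show "\<exists>!u. u \<in> Mor C (Dom C x) (Dom C d') \<and> d' \<cdot> u = x \<and> g \<cdot> u = y"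
  proof (rule ex1I[of _ u])
    fix v assume "v \<in> Mor C (Dom C x) (Dom C d') \<and> d' \<cdot> v = x \<and> g \<cdot> v = y"
    then show "v = u" using u assms(7)[of v "Dom C x" u] unfolding eq by simp
  qed (use u eq in simp)
qed (use assms(1-5) in \<open>auto simp: Mor_iff\<close>)

lemma pullback_ex1:
  assumes "is_pullback C d h d' g" "d' \<in> Mor C P X" "g \<in> Mor C P B"
    and "x \<in> Mor C Y X" "y \<in> Mor C Y B" "d \<cdot> y = h \<cdot> x"
  shows "\<exists>!u. u \<in> Mor C Y P \<and> d' \<cdot> u = x \<and> g \<cdot> u = y"
proof -
  have "x \<in> Arr C" "y \<in> Arr C" "Dom C x = Dom C y \<and> Cod C x = Dom C h \<and> Cod C y = Dom C d \<and> d \<cdot> y = h \<cdot> x"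
    using assms by (auto simp: is_pullback_def Mor_iff)
  then have "\<exists>!u. u \<in> Mor C (Dom C x) (Dom C d') \<and> d' \<cdot> u = x \<and> g \<cdot> u = y"
    using assms(1) unfolding is_pullback_def by blast
  moreover have "Dom C x = Y" "Dom C d' = P" using assms(2,4) by (auto simp: Mor_iff)
  ultimately show ?thesis by simp
qed

lemma pullback_factor:
  assumes "is_pullback C d h d' g" "d' \<in> Mor C P X" "g \<in> Mor C P B"
    and "x \<in> Mor C Y X" "y \<in> Mor C Y B" "d \<cdot> y = h \<cdot> x"
  shows "\<exists>u \<in> Mor C Y P. d' \<cdot> u = x \<and> g \<cdot> u = y"
  using pullback_ex1[OF assms] by blast

lemma pullback_unique:
  assumes "is_pullback C d h d' g" "d' \<in> Mor C P X" "g \<in> Mor C P B"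
    and "u \<in> Mor C Y P" "v \<in> Mor C Y P" "d' \<cdot> u = d' \<cdot> v" "g \<cdot> u = g \<cdot> v"
  shows "u = v"
proof -
  obtain D where t: "d \<in> Mor C B D" "h \<in> Mor C X D" "d \<cdot> g = h \<cdot> d'"
    using is_pullback_typing[OF assms(1)] assms(2,3) by (auto simp: Mor_iff)
  have "\<exists>!w. w \<in> Mor C Y P \<and> d' \<cdot> w = d' \<cdot> v \<and> g \<cdot> w = g \<cdot> v"
    using pullback_ex1[OF assms(1-3) Comp_Mor[OF assms(5,2)] Comp_Mor[OF assms(5,3)]]
      comp_square[OF t(3) assms(3) t(1) assms(2) t(2) assms(5)] by simp
  then show ?thesis using assms(4-7) by blast
qed

lemma is_pushout_intro:
  assumes "i \<in> Mor C A B" "f \<in> Mor C A X" "i' \<in> Mor C X P" "g \<in> Mor C B P" "g \<cdot> i = i' \<cdot> f"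
    and "\<And>Y x y. x \<in> Mor C X Y \<Longrightarrow> y \<in> Mor C B Y \<Longrightarrow> y \<cdot> i = x \<cdot> f
      \<Longrightarrow> \<exists>u \<in> Mor C P Y. u \<cdot> i' = x \<and> u \<cdot> g = y"
    and "\<And>Y u v. u \<in> Mor C P Y \<Longrightarrow> v \<in> Mor C P Y \<Longrightarrow> u \<cdot> i' = v \<cdot> i' \<Longrightarrow> u \<cdot> g = v \<cdot> g \<Longrightarrow> u = v"
  shows "is_pushout C i f i' g"
  unfolding is_pushout_def
proof (intro conjI ballI impI)
  fix x y assume "x \<in> Arr C" "y \<in> Arr C"
    "Cod C x = Cod C y \<and> Dom C x = Cod C f \<and> Dom C y = Cod C i \<and> y \<cdot> i = x \<cdot> f"
  then obtain u where u: "u \<in> Mor C P (Cod C x)" "u \<cdot> i' = x" "u \<cdot> g = y"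
    using assms(1,2) assms(6)[of x "Cod C x" y] by (auto simp: Mor_iff)
  have eq: "Cod C i' = P" using assms(3) by (simp add: Mor_iff)
  show "\<exists>!u. u \<in> Mor C (Cod C i') (Cod C x) \<and> u \<cdot> i' = x \<and> u \<cdot> g = y"
  proof (rule ex1I[of _ u])
    fix v assume "v \<in> Mor C (Cod C i') (Cod C x) \<and> v \<cdot> i' = x \<and> v \<cdot> g = y"
    then show "v = u" using u assms(7)[of v "Cod C x" u] unfolding eq by simp
  qed (use u eq in simp)
qed (use assms(1-5) in \<open>auto simp: Mor_iff\<close>)

text \<open>The cancellation half of the pasting law: the outer rectangle and the right-hand square are
  pullbacks, hence so is the left-hand square.\<close>

lemma pullback_along_comp:
  assumes pb: "is_pullback C d h d' g" and k: "k \<in> Arr C" "Cod C k = Dom C h"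
    and pb': "is_pullback C d (h \<cdot> k) d'' g'"
  shows "\<exists>u. is_pullback C d' k d'' u"
proof -
  obtain P B X D where t: "d \<in> Mor C B D" "h \<in> Mor C X D" "d' \<in> Mor C P X" "g \<in> Mor C P B"
    "d \<cdot> g = h \<cdot> d'"
    using is_pullback_typing[OF pb] by blast
  obtain Y where kY: "k \<in> Mor C Y X" using k t by (auto simp: Mor_iff)
  obtain Q where t': "d'' \<in> Mor C Q Y" "g' \<in> Mor C Q B" and sq: "d \<cdot> g' = (h \<cdot> k) \<cdot> d''"
    using is_pullback_typing[OF pb'] t kY by (auto simp: Mor_iff)
  have sq': "d \<cdot> g' = h \<cdot> (k \<cdot> d'')" using sq Comp_assoc[OF t'(1) kY t(2)] by simp
  obtain u where u: "u \<in> Mor C Q P" "d' \<cdot> u = k \<cdot> d''" "g \<cdot> u = g'"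
    using pullback_factor[OF pb t(3,4) Comp_Mor[OF t'(1) kY] t'(2) sq'] by metis
  have "is_pullback C d' k d'' u"
  proof (rule is_pullback_intro[OF t(3) kY t'(1) u(1,2)])
    fix Z x y assume xy: "x \<in> Mor C Z Y" "y \<in> Mor C Z P" "d' \<cdot> y = k \<cdot> x"
    have "d \<cdot> (g \<cdot> y) = h \<cdot> (d' \<cdot> y)"
      using comp_square[OF t(5,4,1,3,2) xy(2)] .
    also have "\<dots> = (h \<cdot> k) \<cdot> x" using xy Comp_assoc[OF xy(1) kY t(2)] by simp
    finally obtain w where w: "w \<in> Mor C Z Q" "d'' \<cdot> w = x" "g' \<cdot> w = g \<cdot> y"
      using pullback_factor[OF pb' t' xy(1) Comp_Mor[OF xy(2) t(4)]] by metis
    have "u \<cdot> w = y"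
    proof (rule pullback_unique[OF pb t(3,4) Comp_Mor[OF w(1) u(1)] xy(2)])
      show "d' \<cdot> (u \<cdot> w) = d' \<cdot> y"
        using comp_square[OF u(2,1) t(3) t'(1) kY w(1)] w(2) xy(3) by simp
      show "g \<cdot> (u \<cdot> w) = g \<cdot> y"
        using w comp_reduce[OF u(3) u(1) t(4) w(1)] by simp
    qed
    then show "\<exists>w \<in> Mor C Z Q. d'' \<cdot> w = x \<and> u \<cdot> w = y" using w by blast
  next
    fix Z v w assume vw: "v \<in> Mor C Z Q" "w \<in> Mor C Z Q" "d'' \<cdot> v = d'' \<cdot> w" "u \<cdot> v = u \<cdot> w"
    have "g' \<cdot> v = g' \<cdot> w"
      using comp_reduce[OF u(3) u(1) t(4) vw(1)] comp_reduce[OF u(3) u(1) t(4) vw(2)] vw(4) by simp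
    then show "v = w" using pullback_unique[OF pb' t' vw(1-3)] by simp
  qed
  then show ?thesis by blast
qed

lemma pullback_paste:
  assumes pb: "is_pullback C q h q' g" and pb': "is_pullback C p g p' g'"
    and pq: "Cod C p = Dom C q"
  shows "is_pullback C (q \<cdot> p) h (q' \<cdot> p') g'"
proof -
  obtain P B X D where t: "q \<in> Mor C B D" "h \<in> Mor C X D" "q' \<in> Mor C P X" "g \<in> Mor C P B"
    "q \<cdot> g = h \<cdot> q'"
    using is_pullback_typing[OF pb] by blast
  obtain A Q where t': "p \<in> Mor C A B" "p' \<in> Mor C Q P" "g' \<in> Mor C Q A" "p \<cdot> g' = g \<cdot> p'"
    using is_pullback_typing[OF pb'] t pq by (auto simp: Mor_iff)
  show ?thesis
  proof (rule is_pullback_intro[OF Comp_Mor[OF t'(1) t(1)] t(2) Comp_Mor[OF t'(2) t(3)] t'(3)])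
    show "(q \<cdot> p) \<cdot> g' = h \<cdot> (q' \<cdot> p')"
      using Comp_assoc[OF t'(3,1) t(1)] t'(4) comp_square[OF t(5,4,1,3,2) t'(2)] by simp
  next
    fix Y x y assume xy: "x \<in> Mor C Y X" "y \<in> Mor C Y A" "(q \<cdot> p) \<cdot> y = h \<cdot> x"
    then have "q \<cdot> (p \<cdot> y) = h \<cdot> x" using Comp_assoc[OF xy(2) t'(1) t(1)] by simp
    then obtain v where v: "v \<in> Mor C Y P" "q' \<cdot> v = x" "g \<cdot> v = p \<cdot> y"
      using pullback_factor[OF pb t(3,4) xy(1) Comp_Mor[OF xy(2) t'(1)]] by metis
    obtain w where w: "w \<in> Mor C Y Q" "p' \<cdot> w = v" "g' \<cdot> w = y"
      using pullback_factor[OF pb' t'(2,3) v(1) xy(2) v(3)[symmetric]] by metis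
    have "(q' \<cdot> p') \<cdot> w = x" using Comp_assoc[OF w(1) t'(2) t(3)] w(2) v(2) by simp
    then show "\<exists>w \<in> Mor C Y Q. (q' \<cdot> p') \<cdot> w = x \<and> g' \<cdot> w = y" using w by blast
  next
    fix Y u v assume uv: "u \<in> Mor C Y Q" "v \<in> Mor C Y Q"
      "(q' \<cdot> p') \<cdot> u = (q' \<cdot> p') \<cdot> v" "g' \<cdot> u = g' \<cdot> v"
    have q': "q' \<cdot> (p' \<cdot> u) = q' \<cdot> (p' \<cdot> v)"
      using uv(3) Comp_assoc[OF uv(1) t'(2) t(3)] Comp_assoc[OF uv(2) t'(2) t(3)] by simp
    have "g \<cdot> (p' \<cdot> u) = p \<cdot> (g' \<cdot> u)" "g \<cdot> (p' \<cdot> v) = p \<cdot> (g' \<cdot> v)"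
      using comp_square[OF t'(4,3,1,2) t(4) uv(1)] comp_square[OF t'(4,3,1,2) t(4) uv(2)] by simp_all
    then have "g \<cdot> (p' \<cdot> u) = g \<cdot> (p' \<cdot> v)" using uv by simp
    with q' have "p' \<cdot> u = p' \<cdot> v"
      using pullback_unique[OF pb t(3,4) Comp_Mor[OF uv(1) t'(2)] Comp_Mor[OF uv(2) t'(2)]] by simp
    then show "u = v" using pullback_unique[OF pb' t'(2,3) uv(1,2)] uv by simp
  qed
qed

end

section \<open>Addition of morphisms\<close>

context additive_category
begin

lemma Zero_Mor: "A \<in> Obj C \<Longrightarrow> B \<in> Obj C \<Longrightarrow> Zero C A B \<in> Mor C A B"
  using comm_group.axioms(2)[OF Mor_group] group.is_monoid monoid.one_closed by fastforce

lemma Add_Mor: "f \<in> Mor C A B \<Longrightarrow> g \<in> Mor C A B \<Longrightarrow> Add C f g \<in> Mor C A B"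
  using monoid.m_closed[OF group.is_monoid[OF comm_group.axioms(2)[OF Mor_group]]] Mor_Obj by fastforce

lemma Add_Zero: "f \<in> Mor C A B \<Longrightarrow> Add C f (Zero C A B) = f"
  using monoid.r_one[OF group.is_monoid[OF comm_group.axioms(2)[OF Mor_group]]] Mor_Obj by fastforce

lemma Zero_Add: "f \<in> Mor C A B \<Longrightarrow> Add C (Zero C A B) f = f"
  using monoid.l_one[OF group.is_monoid[OF comm_group.axioms(2)[OF Mor_group]]] Mor_Obj by fastforce

lemma Add_right_cancel:
  assumes "f \<in> Mor C A B" "g \<in> Mor C A B" "h \<in> Mor C A B" "Add C f h = Add C g h"
  shows "f = g"
  using group.right_cancel[OF comm_group.axioms(2)[OF Mor_group[of A B]]] assms Mor_Obj by fastforce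

lemma Add_commute:
  assumes "f \<in> Mor C A B" "g \<in> Mor C A B"
  shows "Add C f g = Add C g f"
proof -
  interpret G: comm_group "\<lparr>carrier = Mor C A B, monoid.mult = Add C, one = Zero C A B\<rparr>"
    using Mor_group assms Mor_Obj by blast
  show ?thesis using G.m_comm assms by simp
qed

text \<open>The equation \<open>h + g = f\<close> stands for \<open>h = f - g\<close>, so that no notation for negatives is needed.\<close>

lemma difference:
  assumes "f \<in> Mor C A B" "g \<in> Mor C A B"
  obtains h where "h \<in> Mor C A B" "Add C h g = f"
proof -
  let ?G = "\<lparr>carrier = Mor C A B, monoid.mult = Add C, one = Zero C A B\<rparr>"
  interpret G: comm_group ?G using Mor_group assms Mor_Obj by blast
  have inv: "inv\<^bsub>?G\<^esub> g \<in> carrier ?G" using assms by (intro G.inv_closed) simp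
  have "f \<otimes>\<^bsub>?G\<^esub> inv\<^bsub>?G\<^esub> g \<in> carrier ?G" using assms inv by (intro G.m_closed) simp_all
  moreover have "(f \<otimes>\<^bsub>?G\<^esub> inv\<^bsub>?G\<^esub> g) \<otimes>\<^bsub>?G\<^esub> g = f"
    using G.m_assoc[OF _ inv, of f g] G.l_inv[of g] G.r_one[of f] assms by simp
  ultimately show thesis using that by simp
qed

lemma Comp_Zero:
  assumes g: "g \<in> Mor C B D" and A: "A \<in> Obj C"
  shows "g \<cdot> Zero C A B = Zero C A D"
proof -
  have z: "Zero C A B \<in> Mor C A B" "Zero C A D \<in> Mor C A D" using Zero_Mor A Mor_Obj g by blast+
  have gz: "g \<cdot> Zero C A B \<in> Mor C A D" using Comp_Mor[OF z(1) g] .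
  have "Add C (g \<cdot> Zero C A B) (g \<cdot> Zero C A B) = Add C (Zero C A D) (g \<cdot> Zero C A B)"
    using Comp_Add[OF z(1,1) g] Zero_Add[OF z(1)] Zero_Add[OF gz] by simp
  then show ?thesis using Add_right_cancel[OF gz z(2) gz] by blast
qed

lemma Zero_Comp:
  assumes f: "f \<in> Mor C A B" and D: "D \<in> Obj C"
  shows "Zero C B D \<cdot> f = Zero C A D"
proof -
  have z: "Zero C B D \<in> Mor C B D" "Zero C A D \<in> Mor C A D" using Zero_Mor D Mor_Obj f by blast+
  have zf: "Zero C B D \<cdot> f \<in> Mor C A D" using Comp_Mor[OF f z(1)] .
  have "Add C (Zero C B D \<cdot> f) (Zero C B D \<cdot> f) = Add C (Zero C A D) (Zero C B D \<cdot> f)"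
    using Add_Comp[OF f z(1,1)] Zero_Add[OF z(1)] Zero_Add[OF zf] by simp
  then show ?thesis using Add_right_cancel[OF zf z(2) zf] by blast
qed

lemma biproduct_arrow_eq:
  assumes S: "is_biproduct C A B S \<iota> \<kappa> \<pi> \<rho>" and u: "u \<in> Mor C S Y" and v: "v \<in> Mor C S Y"
    and eq: "u \<cdot> \<iota> = v \<cdot> \<iota>" "u \<cdot> \<kappa> = v \<cdot> \<kappa>"
  shows "u = v"
proof -
  have t: "\<iota> \<in> Mor C A S" "\<kappa> \<in> Mor C B S" "\<pi> \<in> Mor C S A" "\<rho> \<in> Mor C S B"
    and sum: "Add C (\<iota> \<cdot> \<pi>) (\<kappa> \<cdot> \<rho>) = Id C S"
    using S by (auto simp: is_biproduct_def)
  have "w = Add C ((w \<cdot> \<iota>) \<cdot> \<pi>) ((w \<cdot> \<kappa>) \<cdot> \<rho>)" if w: "w \<in> Mor C S Y" for w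
    using Comp_Add[OF Comp_Mor[OF t(3,1)] Comp_Mor[OF t(4,2)] w] sum Comp_Id[OF w]
      Comp_assoc[OF t(3,1) w] Comp_assoc[OF t(4,2) w] by simp
  from this[OF u] this[OF v] show ?thesis using eq by simp
qed

lemma biproduct_copairing:
  assumes S: "is_biproduct C A B S \<iota> \<kappa> \<pi> \<rho>" and y: "y \<in> Mor C A Y" and z: "z \<in> Mor C B Y"
  shows "\<exists>u \<in> Mor C S Y. u \<cdot> \<iota> = y \<and> u \<cdot> \<kappa> = z"
proof -
  have t: "\<iota> \<in> Mor C A S" "\<kappa> \<in> Mor C B S" "\<pi> \<in> Mor C S A" "\<rho> \<in> Mor C S B"
    and eqs: "\<pi> \<cdot> \<iota> = Id C A" "\<rho> \<cdot> \<kappa> = Id C B" "\<pi> \<cdot> \<kappa> = Zero C B A" "\<rho> \<cdot> \<iota> = Zero C A B"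
    using S by (auto simp: is_biproduct_def)
  have o: "A \<in> Obj C" "B \<in> Obj C" using Mor_Obj y z by blast+
  define u where "u = Add C (y \<cdot> \<pi>) (z \<cdot> \<rho>)"
  have y\<pi>: "y \<cdot> \<pi> \<in> Mor C S Y" and z\<rho>: "z \<cdot> \<rho> \<in> Mor C S Y" using Comp_Mor y z t by blast+
  have "u \<in> Mor C S Y" unfolding u_def using Add_Mor[OF y\<pi> z\<rho>] .
  moreover have "u \<cdot> \<iota> = y"
    unfolding u_def using Add_Comp[OF t(1) y\<pi> z\<rho>] Comp_assoc[OF t(1,3) y] Comp_assoc[OF t(1,4) z]
      eqs(1,4) Comp_Id[OF y] Comp_Zero[OF z o(1)] Add_Zero[OF y] by simp
  moreover have "u \<cdot> \<kappa> = z"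
    unfolding u_def using Add_Comp[OF t(2) y\<pi> z\<rho>] Comp_assoc[OF t(2,3) y] Comp_assoc[OF t(2,4) z]
      eqs(2,3) Comp_Id[OF z] Comp_Zero[OF y o(2)] Zero_Add[OF z] by simp
  ultimately show ?thesis by blast
qed

section \<open>Kernels and cokernels in additive categories\<close>

lemma kernel_mono:
  assumes "is_kernel_of C i d" "i \<in> Mor C A B" "u \<in> Mor C X A" "v \<in> Mor C X A" "i \<cdot> u = i \<cdot> v"
  shows "u = v"
proof -
  obtain D where t: "d \<in> Mor C B D" "d \<cdot> i = Zero C A D"
    using is_kernel_of_typing[OF assms(1)] assms(2) by (auto simp: Mor_iff)
  have "d \<cdot> (i \<cdot> u) = Zero C X D"
    using comp_reduce[OF t(2) assms(2) t(1) assms(3)] Zero_Comp[OF assms(3)] Mor_Obj[OF t(1)]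
    by simp
  moreover have "i \<cdot> u \<in> Arr C" "Cod C (i \<cdot> u) = Dom C d" "Dom C (i \<cdot> u) = X" "Dom C i = A" "Cod C d = D"
    using assms(2,3) t by (auto simp: Mor_iff)
  ultimately have "\<exists>!w. w \<in> Mor C X A \<and> i \<cdot> w = i \<cdot> u"
    using assms(1) unfolding is_kernel_of_def by metis
  then show ?thesis using assms(3-5) by metis
qed

lemma is_cokernel_data:
  assumes "is_cokernel C d" "d \<in> Mor C B D"
  shows "\<exists>i A. is_cokernel_of C d i \<and> i \<in> Mor C A B \<and> d \<cdot> i = Zero C A D"
proof -
  obtain i where i: "is_cokernel_of C d i" using assms(1) unfolding is_cokernel_def by blast
  moreover obtain A where "i \<in> Mor C A B" "d \<cdot> i = Zero C A D"
    using is_cokernel_of_typing[OF i] assms(2) by (auto simp: Mor_iff)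
  ultimately show ?thesis by blast
qed

lemma cokernel_epi:
  assumes "is_cokernel C d" "d \<in> Mor C B D" "u \<in> Mor C D X" "v \<in> Mor C D X" "u \<cdot> d = v \<cdot> d"
  shows "u = v"
proof -
  obtain i A where k: "is_cokernel_of C d i" and t: "i \<in> Mor C A B" "d \<cdot> i = Zero C A D"
    using is_cokernel_data[OF assms(1,2)] by blast
  have "(u \<cdot> d) \<cdot> i = Zero C A X"
    using Comp_assoc[OF t(1) assms(2,3)] t(2) Comp_Zero[OF assms(3)] Mor_Obj[OF t(1)] by simp
  moreover have "u \<cdot> d \<in> Arr C" "Dom C (u \<cdot> d) = Cod C i" "Cod C (u \<cdot> d) = X" "Cod C d = D" "Dom C i = A"
    using assms(2,3) t by (auto simp: Mor_iff)
  ultimately have "\<exists>!w. w \<in> Mor C D X \<and> w \<cdot> d = u \<cdot> d"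
    using k unfolding is_cokernel_of_def by metis
  then show ?thesis using assms(3-5) by metis
qed

lemma cokernel_of_kernel:
  assumes "is_cokernel C d" "is_kernel_of C i d"
  shows "is_cokernel_of C d i"
proof -
  obtain A B D where t: "i \<in> Mor C A B" "d \<in> Mor C B D" "d \<cdot> i = Zero C A D"
    using is_kernel_of_typing[OF assms(2)] by blast
  obtain j J where k: "is_cokernel_of C d j" and j: "j \<in> Mor C J B" "d \<cdot> j = Zero C J D"
    using is_cokernel_data[OF assms(1) t(2)] by blast
  obtain v where v: "v \<in> Mor C J A" "i \<cdot> v = j" using kernel_factor[OF assms(2) t(1,2) j] by blast
  show ?thesis
  proof (rule is_cokernel_of_intro[OF t])
    fix X h assume h: "h \<in> Mor C B X" "h \<cdot> i = Zero C A X"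
    have "h \<cdot> j = Zero C J X"
      using comp_reduce[OF h(2) t(1) h(1) v(1)] v Zero_Comp[OF v(1)] Mor_Obj[OF h(1)] by simp
    then show "\<exists>u \<in> Mor C D X. u \<cdot> d = h" using cokernel_factor[OF k j(1) t(2) h(1)] by metis
  qed (rule cokernel_epi[OF assms(1) t(2)])
qed

text \<open>If \<open>e\<close> and \<open>f\<close> agree after \<open>q\<close>, their difference factors through the kernel of \<open>q\<close> and is
  killed by \<open>x\<close>. This replaces the universal property of \<open>q\<close> as a cokernel where that is not yet known.\<close>

lemma comp_eq_if_kills_kernel:
  assumes k: "is_kernel_of C k q" "k \<in> Mor C K B" "q \<in> Mor C B D"
    and x: "x \<in> Mor C B X" "x \<cdot> k = Zero C K X"
    and ef: "e \<in> Mor C Y B" "f \<in> Mor C Y B" "q \<cdot> e = q \<cdot> f"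
  shows "x \<cdot> e = x \<cdot> f"
proof -
  obtain h where h: "h \<in> Mor C Y B" "Add C h f = e" using difference[OF ef(1,2)] .
  have o: "Y \<in> Obj C" "D \<in> Obj C" "X \<in> Obj C" using Mor_Obj ef k x by blast+
  have "Add C (q \<cdot> h) (q \<cdot> f) = Add C (Zero C Y D) (q \<cdot> f)"
    using Comp_Add[OF h(1) ef(2) k(3)] h(2) ef(3) Zero_Add[OF Comp_Mor[OF ef(2) k(3)]] by simp
  then have "q \<cdot> h = Zero C Y D"
    using Add_right_cancel[OF Comp_Mor[OF h(1) k(3)] _ Comp_Mor[OF ef(2) k(3)]] Zero_Mor[OF o(1,2)]
    by simp
  then obtain u where u: "u \<in> Mor C Y K" "k \<cdot> u = h" using kernel_factor[OF k h(1)] by metis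
  have "x \<cdot> h = Zero C Y X"
    using comp_reduce[OF x(2) k(2) x(1) u(1)] u(2) Zero_Comp[OF u(1) o(3)] by simp
  then show ?thesis
    using Comp_Add[OF h(1) ef(2) x(1)] h(2) Zero_Add[OF Comp_Mor[OF ef(2) x(1)]] by simp
qed

lemma kernel_of_comp:
  assumes q: "q \<in> Mor C B D" and j: "is_kernel_of C j q" and p: "p \<in> Mor C A B"
    and pb: "is_pullback C p j r m"
  shows "is_kernel_of C m (q \<cdot> p)"
proof -
  obtain J where jt: "j \<in> Mor C J B" "q \<cdot> j = Zero C J D"
    using is_kernel_of_typing[OF j] q by (auto simp: Mor_iff)
  obtain K where t: "r \<in> Mor C K J" "m \<in> Mor C K A" "p \<cdot> m = j \<cdot> r"
    using is_pullback_typing[OF pb] p jt by (auto simp: Mor_iff)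
  have D: "D \<in> Obj C" using Mor_Obj q by blast
  show ?thesis
  proof (rule is_kernel_of_intro[OF t(2) Comp_Mor[OF p q]])
    show "(q \<cdot> p) \<cdot> m = Zero C K D"
      using Comp_assoc[OF t(2) p q] t(3) comp_reduce[OF jt(2) jt(1) q t(1)] Zero_Comp[OF t(1) D]
      by simp
  next
    fix X h assume h: "h \<in> Mor C X A" "(q \<cdot> p) \<cdot> h = Zero C X D"
    have "q \<cdot> (p \<cdot> h) = Zero C X D" using h Comp_assoc[OF h(1) p q] by simp
    then obtain x where x: "x \<in> Mor C X J" "j \<cdot> x = p \<cdot> h"
      using kernel_factor[OF j jt(1) q Comp_Mor[OF h(1) p]] by metis
    then show "\<exists>u \<in> Mor C X K. m \<cdot> u = h"
      using pullback_factor[OF pb t(1,2) x(1) h(1) x(2)[symmetric]] by metis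
  next
    fix X u v assume uv: "u \<in> Mor C X K" "v \<in> Mor C X K" "m \<cdot> u = m \<cdot> v"
    have "j \<cdot> (r \<cdot> u) = j \<cdot> (r \<cdot> v)"
      using comp_square[OF t(3,2) p t(1) jt(1)] uv by metis
    then have "r \<cdot> u = r \<cdot> v"
      using kernel_mono[OF j jt(1) Comp_Mor[OF uv(1) t(1)] Comp_Mor[OF uv(2) t(1)]] by simp
    then show "u = v" using pullback_unique[OF pb t(1,2) uv(1,2)] uv(3) by simp
  qed
qed

lemma kernel_of_pullback:
  assumes pb: "is_pullback C d h d' g" and i: "is_kernel_of C i d"
  obtains i' where "is_kernel_of C i' d'" "g \<cdot> i' = i"
proof -
  obtain P B X D where t: "d \<in> Mor C B D" "h \<in> Mor C X D" "d' \<in> Mor C P X" "g \<in> Mor C P B"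
    "d \<cdot> g = h \<cdot> d'"
    using is_pullback_typing[OF pb] by blast
  obtain A where it: "i \<in> Mor C A B" "d \<cdot> i = Zero C A D"
    using is_kernel_of_typing[OF i] t(1) by (auto simp: Mor_iff)
  have o: "A \<in> Obj C" "X \<in> Obj C" using Mor_Obj it t by blast+
  have "d \<cdot> i = h \<cdot> Zero C A X" using it Comp_Zero[OF t(2) o(1)] by simp
  then obtain i' where i': "i' \<in> Mor C A P" "d' \<cdot> i' = Zero C A X" "g \<cdot> i' = i"
    using pullback_factor[OF pb t(3,4) Zero_Mor[OF o] it(1)] by metis
  have "is_kernel_of C i' d'"
  proof (rule is_kernel_of_intro[OF i'(1) t(3) i'(2)])
    fix Y y assume y: "y \<in> Mor C Y P" "d' \<cdot> y = Zero C Y X"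
    have Y: "Y \<in> Obj C" using Mor_Obj y by blast
    have "d \<cdot> (g \<cdot> y) = h \<cdot> (d' \<cdot> y)" using comp_square[OF t(5,4,1,3,2) y(1)] .
    then have "d \<cdot> (g \<cdot> y) = Zero C Y D" using y(2) Comp_Zero[OF t(2) Y] by simp
    then obtain u where u: "u \<in> Mor C Y A" "i \<cdot> u = g \<cdot> y"
      using kernel_factor[OF i it(1) t(1) Comp_Mor[OF y(1) t(4)]] by metis
    have "i' \<cdot> u = y"
    proof (rule pullback_unique[OF pb t(3,4) Comp_Mor[OF u(1) i'(1)] y(1)])
      show "d' \<cdot> (i' \<cdot> u) = d' \<cdot> y"
        using comp_reduce[OF i'(2) i'(1) t(3) u(1)] Zero_Comp[OF u(1) o(2)] y(2) by simp
      show "g \<cdot> (i' \<cdot> u) = g \<cdot> y" using comp_reduce[OF i'(3) i'(1) t(4) u(1)] u(2) by simp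
    qed
    then show "\<exists>u \<in> Mor C Y A. i' \<cdot> u = y" using u(1) by blast
  next
    fix Y u v assume uv: "u \<in> Mor C Y A" "v \<in> Mor C Y A" "i' \<cdot> u = i' \<cdot> v"
    have "i \<cdot> u = i \<cdot> v" using comp_reduce[OF i'(3,1) t(4)] uv by metis
    then show "u = v" using kernel_mono[OF i it(1) uv(1,2)] by simp
  qed
  then show thesis using that i'(3) by blast
qed

text \<open>The kernel of \<open>d : B \<rightarrow> D\<close> is its pullback along \<open>0 \<rightarrow> D\<close>.\<close>

lemma kernel_if_pullbacks:
  assumes d: "d \<in> Mor C B D"
    and pullbacks: "\<And>X h. h \<in> Mor C X D \<Longrightarrow> \<exists>d' g. is_pullback C d h d' g"
  obtains i where "is_kernel_of C i d"
proof -
  obtain Z where Z: "is_zero_object C Z" using ex_zero_object by blast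
  then have ZO: "Z \<in> Obj C" by (simp add: is_zero_object_def)
  have D: "D \<in> Obj C" using Mor_Obj d by blast
  obtain d' i where pb: "is_pullback C d (Zero C Z D) d' i" using pullbacks[OF Zero_Mor[OF ZO D]] by blast
  obtain P where t: "d' \<in> Mor C P Z" "i \<in> Mor C P B" and sq: "d \<cdot> i = Zero C Z D \<cdot> d'"
    using is_pullback_typing[OF pb] d Zero_Mor[OF ZO D] by (auto simp: Mor_iff)
  have "is_kernel_of C i d"
  proof (rule is_kernel_of_intro[OF t(2) d])
    show "d \<cdot> i = Zero C P D" using sq Zero_Comp[OF t(1) D] by simp
  next
    fix X h assume h: "h \<in> Mor C X B" "d \<cdot> h = Zero C X D"
    have z: "Zero C X Z \<in> Mor C X Z" using Mor_Obj[OF h(1)] ZO Zero_Mor by blast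
    have "d \<cdot> h = Zero C Z D \<cdot> Zero C X Z" using h Zero_Comp[OF z D] by simp
    then show "\<exists>u \<in> Mor C X P. i \<cdot> u = h" using pullback_factor[OF pb t z h(1)] by metis
  next
    fix X u v assume uv: "u \<in> Mor C X P" "v \<in> Mor C X P" "i \<cdot> u = i \<cdot> v"
    have "d' \<cdot> u \<in> Mor C X Z" "d' \<cdot> v \<in> Mor C X Z" using Comp_Mor uv t by blast+
    then have "d' \<cdot> u = d' \<cdot> v" using Z Mor_Obj[OF uv(1)] unfolding is_zero_object_def by blast
    then show "u = v" using pullback_unique[OF pb t uv(1,2)] uv(3) by blast
  qed
  then show thesis using that by blast
qed

section \<open>Semi-stable cokernels\<close>

lemma semi_stable_cokernel_has_kernel:
  assumes "semi_stable_cokernel C d"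
  obtains i where "is_kernel_of C i d"
proof -
  from assms obtain B D where d: "d \<in> Mor C B D"
    unfolding semi_stable_cokernel_def is_cokernel_def using is_cokernel_of_typing by blast
  show thesis
  proof (rule kernel_if_pullbacks[OF d _ that])
    fix X h assume "h \<in> Mor C X D"
    then have "h \<in> Arr C" "Cod C h = Cod C d" using d by (auto simp: Mor_iff)
    then show "\<exists>d' g. is_pullback C d h d' g"
      using assms unfolding semi_stable_cokernel_def by blast
  qed
qed

text \<open>By pasting, \<open>d'\<close> has all pullbacks, and they are cokernels. That \<open>d'\<close> itself is a cokernel needs
  an argument, because only some pullback of \<open>d\<close> along \<open>h\<close> is assumed to be one: the pullback of \<open>d'\<close>
  along an identity is a cokernel, and it is isomorphic to \<open>d'\<close>.\<close>

lemma semi_stable_cokernel_pullback: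
  assumes d: "semi_stable_cokernel C d" and pb: "is_pullback C d h d' g"
  shows "semi_stable_cokernel C d'"
proof -
  obtain P B X D where t: "d \<in> Mor C B D" "h \<in> Mor C X D" "d' \<in> Mor C P X" "g \<in> Mor C P B"
    "d \<cdot> g = h \<cdot> d'"
    using is_pullback_typing[OF pb] by blast
  have stable: "\<exists>d'' u. is_pullback C d' k d'' u \<and> is_cokernel C d''"
    if k: "k \<in> Arr C" "Cod C k = X" for k
  proof -
    have "h \<cdot> k \<in> Arr C" "Cod C (h \<cdot> k) = Cod C d" using k t by (auto simp: Mor_iff)
    then obtain d'' g' where pb': "is_pullback C d (h \<cdot> k) d'' g'" "is_cokernel C d''"
      using d unfolding semi_stable_cokernel_def by blast
    moreover have "Cod C k = Dom C h" using k t by (auto simp: Mor_iff)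
    ultimately show ?thesis using pullback_along_comp[OF pb k(1)] by blast
  qed
  have X: "X \<in> Obj C" and P: "P \<in> Obj C" using Mor_Obj t(3) by blast+
  have IdX: "Id C X \<in> Mor C X X" and IdP: "Id C P \<in> Mor C P P" using Id_Mor X P by blast+
  obtain e u where pbI: "is_pullback C d' (Id C X) e u" and e: "is_cokernel C e"
    using stable[of "Id C X"] IdX by (auto simp: Mor_iff)
  obtain Q where tI: "e \<in> Mor C Q X" "u \<in> Mor C Q P" and sq: "d' \<cdot> u = Id C X \<cdot> e"
    using is_pullback_typing[OF pbI] t(3) IdX by (auto simp: Mor_iff)
  have e_eq: "d' \<cdot> u = e" using sq Id_Comp[OF tI(1)] by simp
  have "d' \<cdot> Id C P = Id C X \<cdot> d'" using Id_Comp[OF t(3)] Comp_Id[OF t(3)] by simp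
  then obtain v where v: "v \<in> Mor C P Q" "e \<cdot> v = d'" "u \<cdot> v = Id C P"
    using pullback_factor[OF pbI tI t(3) IdP] by metis
  obtain j J where k: "is_cokernel_of C e j" and j: "j \<in> Mor C J Q" "e \<cdot> j = Zero C J X"
    using is_cokernel_data[OF e tI(1)] by blast
  have coker: "is_cokernel_of C d' (u \<cdot> j)"
  proof (rule is_cokernel_of_intro[OF Comp_Mor[OF j(1) tI(2)] t(3)])
    show "d' \<cdot> (u \<cdot> j) = Zero C J X" using comp_reduce[OF e_eq tI(2) t(3) j(1)] j(2) by simp
  next
    fix Y x assume x: "x \<in> Mor C P Y" "x \<cdot> (u \<cdot> j) = Zero C J Y"
    have "(x \<cdot> u) \<cdot> j = Zero C J Y" using x Comp_assoc[OF j(1) tI(2) x(1)] by simp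
    then obtain y where y: "y \<in> Mor C X Y" "y \<cdot> e = x \<cdot> u"
      using cokernel_factor[OF k j(1) tI(1) Comp_Mor[OF tI(2) x(1)]] by metis
    have "y \<cdot> d' = (y \<cdot> e) \<cdot> v" using v(2) Comp_assoc[OF v(1) tI(1) y(1)] by simp
    also have "\<dots> = x" using y(2) Comp_assoc[OF v(1) tI(2) x(1)] v(3) Comp_Id[OF x(1)] by simp
    finally show "\<exists>y \<in> Mor C X Y. y \<cdot> d' = x" using y(1) by blast
  next
    fix Y x y assume xy: "x \<in> Mor C X Y" "y \<in> Mor C X Y" "x \<cdot> d' = y \<cdot> d'"
    have "x \<cdot> e = y \<cdot> e"
      using e_eq Comp_assoc[OF tI(2) t(3) xy(1)] Comp_assoc[OF tI(2) t(3) xy(2)] xy(3) by metis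
    then show "x = y" using cokernel_epi[OF e tI(1) xy(1,2)] by simp
  qed
  have "is_cokernel C d'" using coker unfolding is_cokernel_def by blast
  moreover have "Cod C d' = X" using t(3) by (simp add: Mor_iff)
  ultimately show ?thesis using stable unfolding semi_stable_cokernel_def by simp
qed

lemma semi_stable_cokernel_is_cokernel: "semi_stable_cokernel C d \<Longrightarrow> is_cokernel C d"
  by (simp add: semi_stable_cokernel_def)

lemma semi_stable_cokernel_ex_pullback:
  assumes "semi_stable_cokernel C d" "d \<in> Mor C B D" "h \<in> Mor C X D"
  shows "\<exists>d' g P. is_pullback C d h d' g \<and> d' \<in> Mor C P X \<and> g \<in> Mor C P B \<and>
    d \<cdot> g = h \<cdot> d' \<and> semi_stable_cokernel C d'"
proof -
  have "h \<in> Arr C" "Cod C h = Cod C d" using assms by (auto simp: Mor_iff)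
  then obtain d' g where pb: "is_pullback C d h d' g"
    using assms(1) unfolding semi_stable_cokernel_def by blast
  moreover obtain P where "d' \<in> Mor C P X" "g \<in> Mor C P B" "d \<cdot> g = h \<cdot> d'"
    using is_pullback_typing[OF pb] assms(2,3) by (auto simp: Mor_iff)
  ultimately show ?thesis using semi_stable_cokernel_pullback[OF assms(1) pb] by blast
qed

text \<open>A map that kills the kernel \<open>m\<close> of \<open>q \<cdot> p\<close> kills the kernel of \<open>p\<close>, so it factors through \<open>p\<close>.
  The factor kills the kernel \<open>j\<close> of \<open>q\<close> because it does so after the epimorphism \<open>r\<close>, the pullback of
  \<open>p\<close> along \<open>j\<close>; therefore it factors through \<open>q\<close>.\<close>

lemma is_cokernel_comp:
  assumes p: "semi_stable_cokernel C p" "p \<in> Mor C A B"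
    and q: "semi_stable_cokernel C q" "q \<in> Mor C B D"
  shows "is_cokernel C (q \<cdot> p)"
proof -
  obtain i where i: "is_kernel_of C i p" using semi_stable_cokernel_has_kernel[OF p(1)] .
  obtain j where j: "is_kernel_of C j q" using semi_stable_cokernel_has_kernel[OF q(1)] .
  obtain I where it: "i \<in> Mor C I A" "p \<cdot> i = Zero C I B"
    using is_kernel_of_typing[OF i] p by (auto simp: Mor_iff)
  obtain J where jt: "j \<in> Mor C J B" "q \<cdot> j = Zero C J D"
    using is_kernel_of_typing[OF j] q by (auto simp: Mor_iff)
  obtain r m K where pb: "is_pullback C p j r m" and t: "r \<in> Mor C K J" "m \<in> Mor C K A"
      "p \<cdot> m = j \<cdot> r" and r: "semi_stable_cokernel C r"
    using semi_stable_cokernel_ex_pullback[OF p jt(1)] by blast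
  obtain a where a: "is_kernel_of C a r" "m \<cdot> a = i" using kernel_of_pullback[OF pb i] .
  have at: "a \<in> Mor C I K"
    using is_kernel_of_typing[OF a(1)] t a(2) it by (auto simp: Mor_iff)
  have "is_kernel_of C m (q \<cdot> p)" using kernel_of_comp[OF q(2) j p(2) pb] .
  then have mz: "(q \<cdot> p) \<cdot> m = Zero C K D"
    using t p q by (auto simp: is_kernel_of_def Mor_iff)
  have pe: "is_cokernel C p" and qe: "is_cokernel C q" and re: "is_cokernel C r"
    using p q r semi_stable_cokernel_is_cokernel by blast+
  have "is_cokernel_of C (q \<cdot> p) m"
  proof (rule is_cokernel_of_intro[OF t(2) Comp_Mor[OF p(2) q(2)] mz])
    fix X x assume x: "x \<in> Mor C A X" "x \<cdot> m = Zero C K X"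
    have X: "X \<in> Obj C" using Mor_Obj x by blast
    have "x \<cdot> i = Zero C I X"
      using comp_reduce[OF x(2) t(2) x(1) at] a(2) Zero_Comp[OF at X] by simp
    then obtain y where y: "y \<in> Mor C B X" "y \<cdot> p = x"
      using cokernel_factor[OF cokernel_of_kernel[OF pe i] it(1) p(2) x(1)] by metis
    have "(y \<cdot> j) \<cdot> r = (y \<cdot> p) \<cdot> m"
      using Comp_assoc[OF t(1) jt(1) y(1)] Comp_assoc[OF t(2) p(2) y(1)] t(3) by simp
    also have "\<dots> = Zero C J X \<cdot> r" using y(2) x(2) Zero_Comp[OF t(1) X] by simp
    finally have "y \<cdot> j = Zero C J X"
      using cokernel_epi[OF re t(1) Comp_Mor[OF jt(1) y(1)]] Zero_Mor[OF _ X] Mor_Obj[OF jt(1)] by blast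
    then obtain z where z: "z \<in> Mor C D X" "z \<cdot> q = y"
      using cokernel_factor[OF cokernel_of_kernel[OF qe j] jt(1) q(2) y(1)] by metis
    have "z \<cdot> (q \<cdot> p) = x" using Comp_assoc[OF p(2) q(2) z(1)] z(2) y(2) by simp
    then show "\<exists>z \<in> Mor C D X. z \<cdot> (q \<cdot> p) = x" using z(1) by blast
  next
    fix X u v assume uv: "u \<in> Mor C D X" "v \<in> Mor C D X" "u \<cdot> (q \<cdot> p) = v \<cdot> (q \<cdot> p)"
    then have "(u \<cdot> q) \<cdot> p = (v \<cdot> q) \<cdot> p" using Comp_assoc p(2) q(2) by metis
    then have "u \<cdot> q = v \<cdot> q"
      using cokernel_epi[OF pe p(2) Comp_Mor[OF q(2) uv(1)] Comp_Mor[OF q(2) uv(2)]] by simp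
    then show "u = v" using cokernel_epi[OF qe q(2) uv(1,2)] by simp
  qed
  then show ?thesis unfolding is_cokernel_def by blast
qed

lemma semi_stable_cokernel_comp:
  assumes p: "semi_stable_cokernel C p" "p \<in> Mor C A B"
    and q: "semi_stable_cokernel C q" "q \<in> Mor C B D"
  shows "semi_stable_cokernel C (q \<cdot> p)"
  unfolding semi_stable_cokernel_def
proof (intro conjI ballI impI)
  show "is_cokernel C (q \<cdot> p)" using is_cokernel_comp[OF p q] .
  fix h assume "h \<in> Arr C" "Cod C h = Cod C (q \<cdot> p)"
  then have h: "h \<in> Mor C (Dom C h) D" using p q by (auto simp: Mor_iff)
  obtain q' g P where pb: "is_pullback C q h q' g" and t: "q' \<in> Mor C P (Dom C h)" "g \<in> Mor C P B"
      and q': "semi_stable_cokernel C q'"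
    using semi_stable_cokernel_ex_pullback[OF q h] by blast
  obtain p' g' Q where pb': "is_pullback C p g p' g'" and t': "p' \<in> Mor C Q P"
      and p': "semi_stable_cokernel C p'"
    using semi_stable_cokernel_ex_pullback[OF p t(2)] by blast
  have "Cod C p = Dom C q" using p q by (simp add: Mor_iff)
  then have "is_pullback C (q \<cdot> p) h (q' \<cdot> p') g'" using pullback_paste[OF pb pb'] by simp
  moreover have "is_cokernel C (q' \<cdot> p')" using is_cokernel_comp[OF p' t' q' t(1)] .
  ultimately show "\<exists>d' g. is_pullback C (q \<cdot> p) h d' g \<and> is_cokernel C d'" by blast
qed

lemma semi_stable_cokernel_Id:
  assumes A: "A \<in> Obj C"
  shows "semi_stable_cokernel C (Id C A)"
proof -
  have coker: "is_cokernel C (Id C X)" if X: "X \<in> Obj C" for X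
  proof -
    have "is_cokernel_of C (Id C X) (Zero C X X)"
    proof (rule is_cokernel_of_intro[OF Zero_Mor[OF X X] Id_Mor[OF X] Id_Comp[OF Zero_Mor[OF X X]]])
      fix Y h assume "h \<in> Mor C X Y"
      then show "\<exists>u \<in> Mor C X Y. u \<cdot> Id C X = h" using Comp_Id by blast
    qed (simp add: Comp_Id)
    then show ?thesis unfolding is_cokernel_def by blast
  qed
  have "is_pullback C (Id C A) h (Id C (Dom C h)) h" if "h \<in> Arr C" "Cod C h = A" for h
  proof -
    have h: "h \<in> Mor C (Dom C h) A" and X: "Dom C h \<in> Obj C" using that Dom_Obj by (auto simp: Mor_iff)
    show ?thesis
    proof (rule is_pullback_intro[OF Id_Mor[OF A] h Id_Mor[OF X] h])
      show "Id C A \<cdot> h = h \<cdot> Id C (Dom C h)" using Id_Comp[OF h] Comp_Id[OF h] by simp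
    next
      fix Y x y assume xy: "x \<in> Mor C Y (Dom C h)" "y \<in> Mor C Y A" "Id C A \<cdot> y = h \<cdot> x"
      then show "\<exists>u \<in> Mor C Y (Dom C h). Id C (Dom C h) \<cdot> u = x \<and> h \<cdot> u = y"
        using Id_Comp[OF xy(1)] Id_Comp[OF xy(2)] by auto
    qed (simp add: Id_Comp)
  qed
  then have "\<exists>d' g. is_pullback C (Id C A) h d' g \<and> is_cokernel C d'" if "h \<in> Arr C" "Cod C h = A" for h
    using that coker[OF Dom_Obj] by blast
  moreover have "Cod C (Id C A) = A" using Id_Mor[OF A] by (simp add: Mor_iff)
  ultimately show ?thesis unfolding semi_stable_cokernel_def using coker[OF A] by simp
qed

end

section \<open>Duality\<close>

definition op_cat :: "('o, 'm, 'z) preadd_cat_scheme \<Rightarrow> ('o, 'm, 'z) preadd_cat_scheme" where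
  "op_cat C = C\<lparr>Dom := Cod C, Cod := Dom C, Comp := (\<lambda>g f. Comp C f g), Zero := (\<lambda>A B. Zero C B A)\<rparr>"

lemma op_cat_simps [simp]:
  "Obj (op_cat C) = Obj C" "Arr (op_cat C) = Arr C" "Dom (op_cat C) = Cod C" "Cod (op_cat C) = Dom C"
  "Id (op_cat C) = Id C" "Comp (op_cat C) g f = Comp C f g" "Add (op_cat C) = Add C"
  "Zero (op_cat C) A B = Zero C B A" "Mor (op_cat C) A B = Mor C B A"
  by (auto simp: op_cat_def Mor_def)

lemma op_cat_op_cat [simp]: "op_cat (op_cat C) = C"
  by (simp add: op_cat_def)

lemma is_kernel_of_op_cat [simp]: "is_kernel_of (op_cat C) i d \<longleftrightarrow> is_cokernel_of C i d"
  unfolding is_kernel_of_def is_cokernel_of_def op_cat_simps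
  by (intro iffI; elim conjE; intro conjI; (assumption | erule sym))

lemma is_cokernel_of_op_cat [simp]: "is_cokernel_of (op_cat C) d i \<longleftrightarrow> is_kernel_of C d i"
  using is_kernel_of_op_cat[of "op_cat C"] by simp

lemma is_pullback_op_cat [simp]: "is_pullback (op_cat C) i f i' g \<longleftrightarrow> is_pushout C i f i' g"
  unfolding is_pullback_def is_pushout_def op_cat_simps by (rule refl)

lemma semi_stable_cokernel_op_cat [simp]: "semi_stable_cokernel (op_cat C) i \<longleftrightarrow> semi_stable_kernel C i"
  by (simp add: semi_stable_cokernel_def semi_stable_kernel_def is_cokernel_def is_kernel_def)

lemma semi_stable_kernel_op_cat [simp]: "semi_stable_kernel (op_cat C) d \<longleftrightarrow> semi_stable_cokernel C d"
  using semi_stable_cokernel_op_cat[of "op_cat C"] by simp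

lemma stable_exact_sequences_op_cat:
  "(d, i) \<in> stable_exact_sequences (op_cat C) \<longleftrightarrow> (i, d) \<in> stable_exact_sequences C"
  by (auto simp: stable_exact_sequences_def short_exact_sequences_def)

lemma deflation_stable_op_cat:
  "deflation (stable_exact_sequences (op_cat C)) i \<longleftrightarrow> inflation (stable_exact_sequences C) i"
  by (simp add: deflation_def inflation_def stable_exact_sequences_op_cat)

lemma (in category) category_op_cat: "category (op_cat C)"
  by unfold_locales
    (auto simp: Dom_Obj Cod_Obj Id_Mor Comp_Id Id_Comp intro: Comp_Mor Comp_assoc[symmetric])

lemma is_zero_object_op_cat [simp]: "is_zero_object (op_cat C) Z \<longleftrightarrow> is_zero_object C Z"
  by (auto simp: is_zero_object_def)

lemma is_biproduct_op_cat [simp]: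
  "is_biproduct (op_cat C) A B S a b p q \<longleftrightarrow> is_biproduct C A B S p q a b"
  by (auto simp: is_biproduct_def)

lemma (in additive_category) additive_category_op_cat: "additive_category (op_cat C)"
proof (intro additive_category.intro[OF category_op_cat] additive_category_axioms.intro)
  fix A B assume "A \<in> Obj (op_cat C)" "B \<in> Obj (op_cat C)"
  then have AB: "A \<in> Obj C" "B \<in> Obj C" by simp_all
  then show "comm_group \<lparr>carrier = Mor (op_cat C) A B, monoid.mult = Add (op_cat C),
      one = Zero (op_cat C) A B\<rparr>"
    using Mor_group[of B A] by simp
  show "\<exists>S i\<^sub>A i\<^sub>B p\<^sub>A p\<^sub>B. is_biproduct (op_cat C) A B S i\<^sub>A i\<^sub>B p\<^sub>A p\<^sub>B"
    using ex_biproduct[OF AB] unfolding is_biproduct_op_cat by blast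
qed (use ex_zero_object in \<open>auto intro: Comp_Add Add_Comp\<close>)

context additive_category
begin

lemma semi_stable_kernel_comp:
  assumes "semi_stable_kernel C f" "f \<in> Mor C A B" "semi_stable_kernel C g" "g \<in> Mor C B D"
  shows "semi_stable_kernel C (g \<cdot> f)"
  using additive_category.semi_stable_cokernel_comp[OF additive_category_op_cat, of g D B f A] assms by simp

lemma semi_stable_kernel_pushout:
  assumes "semi_stable_kernel C i" "is_pushout C i f i' g"
  shows "semi_stable_kernel C i'"
  using additive_category.semi_stable_cokernel_pullback[OF additive_category_op_cat, of i f i' g] assms by simp

lemma semi_stable_kernel_Id: "A \<in> Obj C \<Longrightarrow> semi_stable_kernel C (Id C A)"
  using additive_category.semi_stable_cokernel_Id[OF additive_category_op_cat, of A] by simp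

text \<open>The arrow \<open>(m, r) : K \<rightarrow> A \<oplus> J\<close> is the pushout of \<open>i\<close> along \<open>a\<close>: if \<open>x : K \<rightarrow> Y\<close> and
  \<open>y : A \<rightarrow> Y\<close> satisfy \<open>y \<cdot> i = x \<cdot> a\<close>, then \<open>x - y \<cdot> m\<close> kills \<open>a\<close> and hence factors through \<open>r\<close>.\<close>

lemma semi_stable_kernel_pairing:
  assumes i: "semi_stable_kernel C i" "i \<in> Mor C I A" and m: "m \<in> Mor C K A"
    and a: "is_cokernel_of C r a" "a \<in> Mor C I K" "r \<in> Mor C K J" and ma: "m \<cdot> a = i"
    and S: "is_biproduct C A J S \<iota> \<kappa> \<pi> \<rho>"
  shows "semi_stable_kernel C (Add C (\<iota> \<cdot> m) (\<kappa> \<cdot> r))"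
proof -
  have St: "\<iota> \<in> Mor C A S" "\<kappa> \<in> Mor C J S" using S by (auto simp: is_biproduct_def)
  have I: "I \<in> Obj C" using Mor_Obj i(2) by blast
  have ra: "r \<cdot> a = Zero C I J" using a by (auto simp: is_cokernel_of_def Mor_iff)
  have rc: "is_cokernel C r" using a(1) by (auto simp: is_cokernel_def)
  have \<iota>m: "\<iota> \<cdot> m \<in> Mor C K S" and \<kappa>r: "\<kappa> \<cdot> r \<in> Mor C K S" using Comp_Mor m a St by blast+
  define t where "t = Add C (\<iota> \<cdot> m) (\<kappa> \<cdot> r)"
  have t: "t \<in> Mor C K S" unfolding t_def using Add_Mor[OF \<iota>m \<kappa>r] .
  have eval: "u \<cdot> t = Add C ((u \<cdot> \<iota>) \<cdot> m) ((u \<cdot> \<kappa>) \<cdot> r)" if u: "u \<in> Mor C S Y" for u Y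
    unfolding t_def using Comp_Add[OF \<iota>m \<kappa>r u] Comp_assoc[OF m St(1) u] Comp_assoc[OF a(3) St(2) u]
    by simp
  have "is_pushout C i a t \<iota>"
  proof (rule is_pushout_intro[OF i(2) a(2) t St(1)])
    have "(\<kappa> \<cdot> r) \<cdot> a = Zero C I S"
      using Comp_assoc[OF a(2,3) St(2)] ra Comp_Zero[OF St(2) I] by simp
    moreover have "(\<iota> \<cdot> m) \<cdot> a = \<iota> \<cdot> i" using Comp_assoc[OF a(2) m St(1)] ma by simp
    ultimately show "\<iota> \<cdot> i = t \<cdot> a"
      unfolding t_def using Add_Comp[OF a(2) \<iota>m \<kappa>r] Add_Zero[OF Comp_Mor[OF i(2) St(1)]] by simp
  next
    fix Y x y assume x: "x \<in> Mor C K Y" and y: "y \<in> Mor C A Y" and yi: "y \<cdot> i = x \<cdot> a"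
    have Y: "Y \<in> Obj C" using Mor_Obj x by blast
    have ym: "y \<cdot> m \<in> Mor C K Y" using Comp_Mor[OF m y] .
    \<comment> \<open>\<open>c\<close> is \<open>x - y \<cdot> m\<close>.\<close>
    obtain c where c: "c \<in> Mor C K Y" "Add C c (y \<cdot> m) = x" using difference[OF x ym] .
    have "Add C (c \<cdot> a) (x \<cdot> a) = Add C (Zero C I Y) (x \<cdot> a)"
      using Add_Comp[OF a(2) c(1) ym] c(2) Comp_assoc[OF a(2) m y] ma yi
        Zero_Add[OF Comp_Mor[OF a(2) x]] by simp
    then have "c \<cdot> a = Zero C I Y"
      using Add_right_cancel[OF Comp_Mor[OF a(2) c(1)] Zero_Mor[OF I Y] Comp_Mor[OF a(2) x]] by simp
    then obtain z where z: "z \<in> Mor C J Y" "z \<cdot> r = c" using cokernel_factor[OF a c(1)] by metis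
    obtain u where u: "u \<in> Mor C S Y" and u\<iota>: "u \<cdot> \<iota> = y" and u\<kappa>: "u \<cdot> \<kappa> = z"
      using biproduct_copairing[OF S y z(1)] by blast
    have "u \<cdot> t = x"
      using eval[OF u] u\<iota> u\<kappa> z(2) c(2) Add_commute[OF c(1) ym] by simp
    then show "\<exists>u \<in> Mor C S Y. u \<cdot> t = x \<and> u \<cdot> \<iota> = y" using u u\<iota> by blast
  next
    fix Y u v assume u: "u \<in> Mor C S Y" and v: "v \<in> Mor C S Y" and eq: "u \<cdot> t = v \<cdot> t" "u \<cdot> \<iota> = v \<cdot> \<iota>"
    have u\<kappa>: "u \<cdot> \<kappa> \<in> Mor C J Y" and v\<kappa>: "v \<cdot> \<kappa> \<in> Mor C J Y" using Comp_Mor u v St by blast+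
    have u\<kappa>r: "(u \<cdot> \<kappa>) \<cdot> r \<in> Mor C K Y" and v\<kappa>r: "(v \<cdot> \<kappa>) \<cdot> r \<in> Mor C K Y"
      using Comp_Mor[OF a(3)] u\<kappa> v\<kappa> by blast+
    have u\<iota>m: "(u \<cdot> \<iota>) \<cdot> m \<in> Mor C K Y" using Comp_Mor[OF m Comp_Mor[OF St(1) u]] .
    have "(u \<cdot> \<kappa>) \<cdot> r = (v \<cdot> \<kappa>) \<cdot> r"
      using eval[OF u] eval[OF v] eq Add_right_cancel[OF u\<kappa>r v\<kappa>r u\<iota>m]
        Add_commute[OF u\<iota>m u\<kappa>r] Add_commute[OF u\<iota>m v\<kappa>r] by simp
    then have \<kappa>: "u \<cdot> \<kappa> = v \<cdot> \<kappa>" using cokernel_epi[OF rc a(3) u\<kappa> v\<kappa>] by simp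
    show "u = v" using biproduct_arrow_eq[OF S u v eq(2) \<kappa>] .
  qed
  then show ?thesis using semi_stable_kernel_pushout[OF i(1)] unfolding t_def by blast
qed

text \<open>The arrow \<open>1 \<oplus> j\<close> is the pushout of \<open>j\<close> along the inclusion of \<open>J\<close> into \<open>A \<oplus> J\<close>.\<close>

lemma semi_stable_kernel_direct_sum:
  assumes j: "semi_stable_kernel C j" "j \<in> Mor C J B"
    and S: "is_biproduct C A J S \<iota> \<kappa> \<pi> \<rho>" and S': "is_biproduct C A B S' \<iota>' \<kappa>' \<pi>' \<rho>'"
  shows "semi_stable_kernel C (Add C (\<iota>' \<cdot> \<pi>) (\<kappa>' \<cdot> (j \<cdot> \<rho>)))"
proof -
  have t: "\<iota> \<in> Mor C A S" "\<kappa> \<in> Mor C J S" "\<pi> \<in> Mor C S A" "\<rho> \<in> Mor C S J"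
    and eqs: "\<pi> \<cdot> \<iota> = Id C A" "\<rho> \<cdot> \<kappa> = Id C J" "\<pi> \<cdot> \<kappa> = Zero C J A" "\<rho> \<cdot> \<iota> = Zero C A J"
    using S by (auto simp: is_biproduct_def)
  have t': "\<iota>' \<in> Mor C A S'" "\<kappa>' \<in> Mor C B S'" using S' by (auto simp: is_biproduct_def)
  have o: "A \<in> Obj C" "J \<in> Obj C" using Mor_Obj t j by blast+
  have j\<rho>: "j \<cdot> \<rho> \<in> Mor C S B" using Comp_Mor[OF t(4) j(2)] .
  have \<iota>\<pi>: "\<iota>' \<cdot> \<pi> \<in> Mor C S S'" and \<kappa>j\<rho>: "\<kappa>' \<cdot> (j \<cdot> \<rho>) \<in> Mor C S S'" using Comp_Mor t t' j\<rho> by blast+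
  define w where "w = Add C (\<iota>' \<cdot> \<pi>) (\<kappa>' \<cdot> (j \<cdot> \<rho>))"
  have w: "w \<in> Mor C S S'" unfolding w_def using Add_Mor[OF \<iota>\<pi> \<kappa>j\<rho>] .
  have w\<iota>: "w \<cdot> \<iota> = \<iota>'"
  proof -
    have "(\<iota>' \<cdot> \<pi>) \<cdot> \<iota> = \<iota>'" using Comp_assoc[OF t(1,3) t'(1)] eqs(1) Comp_Id[OF t'(1)] by simp
    moreover have "(\<kappa>' \<cdot> (j \<cdot> \<rho>)) \<cdot> \<iota> = Zero C A S'"
      using Comp_assoc[OF t(1) j\<rho> t'(2)] Comp_assoc[OF t(1,4) j(2)] eqs(4)
        Comp_Zero[OF j(2) o(1)] Comp_Zero[OF t'(2) o(1)] by simp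
    ultimately show ?thesis unfolding w_def using Add_Comp[OF t(1) \<iota>\<pi> \<kappa>j\<rho>] Add_Zero[OF t'(1)] by simp
  qed
  have w\<kappa>: "\<kappa>' \<cdot> j = w \<cdot> \<kappa>"
  proof -
    have "(\<iota>' \<cdot> \<pi>) \<cdot> \<kappa> = Zero C J S'"
      using Comp_assoc[OF t(2,3) t'(1)] eqs(3) Comp_Zero[OF t'(1) o(2)] by simp
    moreover have "(\<kappa>' \<cdot> (j \<cdot> \<rho>)) \<cdot> \<kappa> = \<kappa>' \<cdot> j"
      using Comp_assoc[OF t(2) j\<rho> t'(2)] Comp_assoc[OF t(2,4) j(2)] eqs(2) Comp_Id[OF j(2)] by simp
    ultimately show ?thesis
      unfolding w_def using Add_Comp[OF t(2) \<iota>\<pi> \<kappa>j\<rho>] Zero_Add[OF Comp_Mor[OF j(2) t'(2)]] by simp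
  qed
  have "is_pushout C j \<kappa> w \<kappa>'"
  proof (rule is_pushout_intro[OF j(2) t(2) w t'(2) w\<kappa>])
    fix Y x y assume x: "x \<in> Mor C S Y" and y: "y \<in> Mor C B Y" and yj: "y \<cdot> j = x \<cdot> \<kappa>"
    have x\<iota>: "x \<cdot> \<iota> \<in> Mor C A Y" using Comp_Mor[OF t(1) x] .
    obtain u where u: "u \<in> Mor C S' Y" and u\<iota>: "u \<cdot> \<iota>' = x \<cdot> \<iota>" and u\<kappa>: "u \<cdot> \<kappa>' = y"
      using biproduct_copairing[OF S' x\<iota> y] by blast
    have "u \<cdot> w = x"
    proof (rule biproduct_arrow_eq[OF S Comp_Mor[OF w u] x])
      show "(u \<cdot> w) \<cdot> \<iota> = x \<cdot> \<iota>" using Comp_assoc[OF t(1) w u] w\<iota> u\<iota> by simp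
      show "(u \<cdot> w) \<cdot> \<kappa> = x \<cdot> \<kappa>"
        using Comp_assoc[OF t(2) w u] w\<kappa> Comp_assoc[OF j(2) t'(2) u] u\<kappa> yj by simp
    qed
    then show "\<exists>u \<in> Mor C S' Y. u \<cdot> w = x \<and> u \<cdot> \<kappa>' = y" using u u\<kappa> by blast
  next
    fix Y u v assume u: "u \<in> Mor C S' Y" and v: "v \<in> Mor C S' Y"
      and eq: "u \<cdot> w = v \<cdot> w" "u \<cdot> \<kappa>' = v \<cdot> \<kappa>'"
    have "u \<cdot> \<iota>' = v \<cdot> \<iota>'"
      using Comp_assoc[OF t(1) w u] Comp_assoc[OF t(1) w v] w\<iota> eq(1) by simp
    then show "u = v" using biproduct_arrow_eq[OF S' u v] eq(2) by blast
  qed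
  then show ?thesis using semi_stable_kernel_pushout[OF j(1)] unfolding w_def by blast
qed

text \<open>A cokernel is the cokernel of any of its kernels, so a stable deflation is recognised without
  producing the whole sequence.\<close>

lemma deflation_stable_iff:
  "deflation (stable_exact_sequences C) d \<longleftrightarrow>
    semi_stable_cokernel C d \<and> (\<exists>i. is_kernel_of C i d \<and> semi_stable_kernel C i)"
  unfolding deflation_def stable_exact_sequences_def short_exact_sequences_def
  using cokernel_of_kernel semi_stable_cokernel_is_cokernel by blast

lemma deflation_stable_Id_zero:
  assumes Z: "is_zero_object C Z"
  shows "deflation (stable_exact_sequences C) (Id C Z)"
proof -
  have ZO: "Z \<in> Obj C" using Z by (simp add: is_zero_object_def)
  have I: "Id C Z \<in> Mor C Z Z" using Id_Mor[OF ZO] .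
  have "Id C Z \<cdot> Id C Z = Zero C Z Z"
    using Z ZO Comp_Mor[OF I I] Zero_Mor[OF ZO ZO] unfolding is_zero_object_def by blast
  then have "is_kernel_of C (Id C Z) (Id C Z)"
    by (rule is_kernel_of_intro[OF I I]) (auto simp: Id_Comp)
  then show ?thesis
    using semi_stable_cokernel_Id[OF ZO] semi_stable_kernel_Id[OF ZO] by (auto simp: deflation_stable_iff)
qed

end

section \<open>Cancellation in weakly idempotent complete categories\<close>

locale wic_additive_category = additive_category +
  assumes wic: "weakly_idempotent_complete C"
begin

text \<open>Every section has a cokernel: if \<open>r \<cdot> s = 1\<close> and \<open>k\<close> is a kernel of \<open>r\<close>, then \<open>1 - s \<cdot> r\<close> factors as
  \<open>k \<cdot> t\<close>, and \<open>t\<close> is a cokernel of \<open>s\<close>.\<close>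

lemma weakly_idempotent_complete_op_cat: "weakly_idempotent_complete (op_cat C)"
  unfolding weakly_idempotent_complete_def
proof (intro allI impI)
  fix s assume "is_retraction (op_cat C) s"
  then obtain A B r where s: "s \<in> Mor C A B" and r: "r \<in> Mor C B A" and rs: "r \<cdot> s = Id C A"
    by (auto simp: is_retraction_def Mor_iff)
  have o: "A \<in> Obj C" "B \<in> Obj C" using Mor_Obj s by blast+
  have "is_retraction C r" using r s rs by (auto simp: is_retraction_def Mor_iff)
  then obtain k where k: "is_kernel_of C k r" using wic unfolding weakly_idempotent_complete_def by blast
  obtain K where kt: "k \<in> Mor C K B" "r \<cdot> k = Zero C K A"
    using is_kernel_of_typing[OF k] r by (auto simp: Mor_iff)
  have K: "K \<in> Obj C" using Mor_Obj kt by blast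
  have sr: "s \<cdot> r \<in> Mor C B B" using Comp_Mor[OF r s] .
  \<comment> \<open>\<open>e\<close> is the complementary idempotent \<open>1 - s \<cdot> r\<close>.\<close>
  obtain e where e: "e \<in> Mor C B B" "Add C e (s \<cdot> r) = Id C B"
    using difference[OF Id_Mor[OF o(2)] sr] .
  have "r \<cdot> (s \<cdot> r) = r" using comp_reduce[OF rs s r r] Id_Comp[OF r] by simp
  then have "Add C (r \<cdot> e) r = Add C (Zero C B A) r"
    using Comp_Add[OF e(1) sr r] e(2) Comp_Id[OF r] Zero_Add[OF r] by simp
  then have "r \<cdot> e = Zero C B A"
    using Add_right_cancel[OF Comp_Mor[OF e(1) r] Zero_Mor[OF o(2,1)] r] by simp
  then obtain t where t: "t \<in> Mor C B K" "k \<cdot> t = e" using kernel_factor[OF k kt(1) r e(1)] by metis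
  have "(s \<cdot> r) \<cdot> s = s" using Comp_assoc[OF s r s] rs Comp_Id[OF s] by simp
  then have "Add C (e \<cdot> s) s = Add C (Zero C A B) s"
    using Add_Comp[OF s e(1) sr] e(2) Id_Comp[OF s] Zero_Add[OF s] by simp
  then have es: "e \<cdot> s = Zero C A B"
    using Add_right_cancel[OF Comp_Mor[OF s e(1)] Zero_Mor[OF o] s] by simp
  have ts: "t \<cdot> s = Zero C A K"
  proof (rule kernel_mono[OF k kt(1) Comp_Mor[OF s t(1)] Zero_Mor[OF o(1) K]])
    show "k \<cdot> (t \<cdot> s) = k \<cdot> Zero C A K"
      using comp_reduce[OF t(2) t(1) kt(1) s] es Comp_Zero[OF kt(1) o(1)] by simp
  qed
  have srk: "(s \<cdot> r) \<cdot> k = Zero C K B"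
    using Comp_assoc[OF kt(1) r s] kt(2) Comp_Zero[OF s K] by simp
  have tk: "t \<cdot> k = Id C K"
  proof (rule kernel_mono[OF k kt(1) Comp_Mor[OF kt(1) t(1)] Id_Mor[OF K]])
    have "k = Add C (e \<cdot> k) ((s \<cdot> r) \<cdot> k)"
      using Add_Comp[OF kt(1) e(1) sr] e(2) Id_Comp[OF kt(1)] by simp
    then have "e \<cdot> k = k" using srk Add_Zero[OF Comp_Mor[OF kt(1) e(1)]] by simp
    then show "k \<cdot> (t \<cdot> k) = k \<cdot> Id C K"
      using comp_reduce[OF t(2) t(1) kt(1) kt(1)] Comp_Id[OF kt(1)] by simp
  qed
  have "is_cokernel_of C t s"
  proof (rule is_cokernel_of_intro[OF s t(1) ts])
    fix X h assume h: "h \<in> Mor C B X" "h \<cdot> s = Zero C A X"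
    have X: "X \<in> Obj C" using Mor_Obj h by blast
    have "h \<cdot> (s \<cdot> r) = Zero C B X" using comp_reduce[OF h(2) s h(1) r] Zero_Comp[OF r X] by simp
    then have "h = h \<cdot> e"
      using Comp_Add[OF e(1) sr h(1)] e(2) Comp_Id[OF h(1)] Add_Zero[OF Comp_Mor[OF e(1) h(1)]] by simp
    then have "(h \<cdot> k) \<cdot> t = h" using Comp_assoc[OF t(1) kt(1) h(1)] t(2) by simp
    then show "\<exists>u \<in> Mor C K X. u \<cdot> t = h" using Comp_Mor[OF kt(1) h(1)] by blast
  next
    fix X u v assume uv: "u \<in> Mor C K X" "v \<in> Mor C K X" "u \<cdot> t = v \<cdot> t"
    have "u = (u \<cdot> t) \<cdot> k" "v = (v \<cdot> t) \<cdot> k"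
      using Comp_assoc[OF kt(1) t(1) uv(1)] Comp_assoc[OF kt(1) t(1) uv(2)] tk Comp_Id[OF uv(1)]
        Comp_Id[OF uv(2)] by simp_all
    then show "u = v" using uv(3) by simp
  qed
  then show "\<exists>i. is_kernel_of (op_cat C) i s" by auto
qed

lemma wic_additive_category_op_cat: "wic_additive_category (op_cat C)"
  using additive_category_op_cat weakly_idempotent_complete_op_cat
  by (simp add: wic_additive_category_def wic_additive_category_axioms_def)

text \<open>The pullback of \<open>q\<close> along \<open>h\<close> is the kernel of \<open>w = (q, -h) : B \<oplus> X \<rightarrow> D\<close>. To construct it, take the
  pullback \<open>P\<close> of \<open>q \<cdot> p\<close> along \<open>w\<close>. Its projection \<open>\<beta> : P \<rightarrow> A\<close> has a section, because
  \<open>q \<cdot> p\<close> itself factors through \<open>w\<close>, namely as \<open>w\<close> after \<open>p\<close> followed by the inclusion of \<open>B\<close>. So \<open>\<beta>\<close> has a kernel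
  by weak idempotent completeness, and the kernel of \<open>\<beta>\<close>, mapped to \<open>B \<oplus> X\<close>, is the kernel of \<open>w\<close>.\<close>

lemma ex_pullback_of_right_factor:
  assumes p: "p \<in> Mor C A B" and q: "q \<in> Mor C B D" and qp: "semi_stable_cokernel C (q \<cdot> p)"
    and h: "h \<in> Mor C X D"
  shows "\<exists>q' g. is_pullback C q h q' g"
proof -
  have o: "A \<in> Obj C" "B \<in> Obj C" "D \<in> Obj C" "X \<in> Obj C" using Mor_Obj p q h by blast+
  obtain n where n: "n \<in> Mor C X D" "Add C n h = Zero C X D"
    using difference[OF Zero_Mor[OF o(4,3)] h] .
  obtain S b x \<pi> \<rho> where "is_biproduct C B X S b x \<pi> \<rho>" using ex_biproduct[OF o(2,4)] by blast
  then have S: "b \<in> Mor C B S" "x \<in> Mor C X S" "\<pi> \<in> Mor C S B" "\<rho> \<in> Mor C S X"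
    and S_eqs: "\<pi> \<cdot> b = Id C B" "\<rho> \<cdot> x = Id C X" "\<pi> \<cdot> x = Zero C X B" "\<rho> \<cdot> b = Zero C B X"
      "Add C (b \<cdot> \<pi>) (x \<cdot> \<rho>) = Id C S"
    by (auto simp: is_biproduct_def)
  \<comment> \<open>\<open>n\<close> is \<open>- h\<close>, so \<open>w\<close> is \<open>(q, -h)\<close>.\<close>
  define w where "w = Add C (q \<cdot> \<pi>) (n \<cdot> \<rho>)"
  have w: "w \<in> Mor C S D"
    unfolding w_def using Add_Mor Comp_Mor[OF S(3) q] Comp_Mor[OF S(4) n(1)] by blast
  have w_eval: "w \<cdot> z = Add C (q \<cdot> (\<pi> \<cdot> z)) (n \<cdot> (\<rho> \<cdot> z))" if z: "z \<in> Mor C Y S" for Y z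
    unfolding w_def using Add_Comp[OF z Comp_Mor[OF S(3) q] Comp_Mor[OF S(4) n(1)]]
      Comp_assoc[OF z S(3) q] Comp_assoc[OF z S(4) n(1)] by simp
  have w_zero: "w \<cdot> z = Zero C Y D \<longleftrightarrow> q \<cdot> (\<pi> \<cdot> z) = h \<cdot> (\<rho> \<cdot> z)" if z: "z \<in> Mor C Y S" for Y z
  proof -
    have m: "q \<cdot> (\<pi> \<cdot> z) \<in> Mor C Y D" "n \<cdot> (\<rho> \<cdot> z) \<in> Mor C Y D" "h \<cdot> (\<rho> \<cdot> z) \<in> Mor C Y D"
      using Comp_Mor z S q n h by meson+
    have Y: "Y \<in> Obj C" using Mor_Obj z by blast
    have \<rho>z: "\<rho> \<cdot> z \<in> Mor C Y X" using Comp_Mor[OF z S(4)] .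
    have nh: "Add C (n \<cdot> (\<rho> \<cdot> z)) (h \<cdot> (\<rho> \<cdot> z)) = Zero C Y D"
      using Add_Comp[OF \<rho>z n(1) h] n(2) Zero_Comp[OF \<rho>z o(3)] by simp
    have "Add C (h \<cdot> (\<rho> \<cdot> z)) (n \<cdot> (\<rho> \<cdot> z)) = Zero C Y D"
      using nh Add_commute[OF m(2,3)] by simp
    then show ?thesis
      using w_eval[OF z] Add_right_cancel[OF m(1,3,2)] by metis
  qed
  obtain e \<beta> P where pb: "is_pullback C (q \<cdot> p) w e \<beta>" and t: "e \<in> Mor C P S" "\<beta> \<in> Mor C P A"
      "(q \<cdot> p) \<cdot> \<beta> = w \<cdot> e"
    using semi_stable_cokernel_ex_pullback[OF qp Comp_Mor[OF p q] w] by blast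
  have bp: "b \<cdot> p \<in> Mor C A S" using Comp_Mor[OF p S(1)] .
  have "w \<cdot> (b \<cdot> p) = q \<cdot> p"
  proof -
    have "\<pi> \<cdot> (b \<cdot> p) = p" "\<rho> \<cdot> (b \<cdot> p) = Zero C A X"
      using comp_reduce[OF S_eqs(1) S(1,3) p] comp_reduce[OF S_eqs(4) S(1,4) p]
        Id_Comp[OF p] Zero_Comp[OF p o(4)] by auto
    then show ?thesis
      using w_eval[OF bp] Comp_Zero[OF n(1) o(1)] Add_Zero[OF Comp_Mor[OF p q]] by simp
  qed
  then have "(q \<cdot> p) \<cdot> Id C A = w \<cdot> (b \<cdot> p)" using Comp_Id[OF Comp_Mor[OF p q]] by simp
  then obtain s where "s \<in> Mor C A P" "\<beta> \<cdot> s = Id C A"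
    using pullback_factor[OF pb t(1,2) bp Id_Mor[OF o(1)]] by metis
  then have "is_retraction C \<beta>" using t(2) by (auto simp: is_retraction_def Mor_iff)
  then obtain k where k: "is_kernel_of C k \<beta>" using wic unfolding weakly_idempotent_complete_def by blast
  obtain N where kt: "k \<in> Mor C N P" "\<beta> \<cdot> k = Zero C N A"
    using is_kernel_of_typing[OF k] t(2) by (auto simp: Mor_iff)
  have N: "N \<in> Obj C" using Mor_Obj kt by blast
  have ek: "e \<cdot> k \<in> Mor C N S" using Comp_Mor[OF kt(1) t(1)] .
  have "w \<cdot> (e \<cdot> k) = (q \<cdot> p) \<cdot> (\<beta> \<cdot> k)"
    using Comp_assoc[OF kt(1) t(1) w] t(3) Comp_assoc[OF kt(1) t(2) Comp_Mor[OF p q]] by simp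
  then have "w \<cdot> (e \<cdot> k) = Zero C N D" using kt(2) Comp_Zero[OF Comp_Mor[OF p q] N] by simp
  then have sq: "q \<cdot> (\<pi> \<cdot> (e \<cdot> k)) = h \<cdot> (\<rho> \<cdot> (e \<cdot> k))" using w_zero[OF ek] by simp
  have "is_pullback C q h (\<rho> \<cdot> (e \<cdot> k)) (\<pi> \<cdot> (e \<cdot> k))"
  proof (rule is_pullback_intro[OF q h Comp_Mor[OF ek S(4)] Comp_Mor[OF ek S(3)] sq])
    fix Y f g assume f: "f \<in> Mor C Y X" and g: "g \<in> Mor C Y B" and gf: "q \<cdot> g = h \<cdot> f"
    have Y: "Y \<in> Obj C" using Mor_Obj f by blast
    define z where "z = Add C (b \<cdot> g) (x \<cdot> f)"
    have bg: "b \<cdot> g \<in> Mor C Y S" and xf: "x \<cdot> f \<in> Mor C Y S" using Comp_Mor f g S by blast+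
    have z: "z \<in> Mor C Y S" unfolding z_def using Add_Mor bg xf by blast
    have \<pi>z: "\<pi> \<cdot> z = g"
      unfolding z_def using Comp_Add[OF bg xf S(3)] comp_reduce[OF S_eqs(1) S(1,3) g]
        comp_reduce[OF S_eqs(3) S(2,3) f] Id_Comp[OF g] Zero_Comp[OF f o(2)] Add_Zero[OF g] by simp
    have \<rho>z: "\<rho> \<cdot> z = f"
      unfolding z_def using Comp_Add[OF bg xf S(4)] comp_reduce[OF S_eqs(4) S(1,4) g]
        comp_reduce[OF S_eqs(2) S(2,4) f] Id_Comp[OF f] Zero_Comp[OF g o(4)] Zero_Add[OF f] by simp
    have "(q \<cdot> p) \<cdot> Zero C Y A = w \<cdot> z"
      using w_zero[OF z] \<pi>z \<rho>z gf Comp_Zero[OF Comp_Mor[OF p q] Y] by simp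
    then obtain u where u: "u \<in> Mor C Y P" "e \<cdot> u = z" "\<beta> \<cdot> u = Zero C Y A"
      using pullback_factor[OF pb t(1,2) z Zero_Mor[OF Y o(1)]] by metis
    then obtain v where v: "v \<in> Mor C Y N" "k \<cdot> v = u" using kernel_factor[OF k kt(1) t(2)] by metis
    have "(e \<cdot> k) \<cdot> v = z" using Comp_assoc[OF v(1) kt(1) t(1)] v(2) u(2) by simp
    then have "(\<rho> \<cdot> (e \<cdot> k)) \<cdot> v = f \<and> (\<pi> \<cdot> (e \<cdot> k)) \<cdot> v = g"
      using Comp_assoc[OF v(1) ek S(4)] Comp_assoc[OF v(1) ek S(3)] \<pi>z \<rho>z by simp
    then show "\<exists>v \<in> Mor C Y N. (\<rho> \<cdot> (e \<cdot> k)) \<cdot> v = f \<and> (\<pi> \<cdot> (e \<cdot> k)) \<cdot> v = g"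
      using v(1) by blast
  next
    fix Y u v assume uv: "u \<in> Mor C Y N" "v \<in> Mor C Y N"
      "(\<rho> \<cdot> (e \<cdot> k)) \<cdot> u = (\<rho> \<cdot> (e \<cdot> k)) \<cdot> v" "(\<pi> \<cdot> (e \<cdot> k)) \<cdot> u = (\<pi> \<cdot> (e \<cdot> k)) \<cdot> v"
    have Y: "Y \<in> Obj C" using Mor_Obj uv by blast
    have split: "z = Add C (b \<cdot> (\<pi> \<cdot> z)) (x \<cdot> (\<rho> \<cdot> z))" if z: "z \<in> Mor C Y S" for z
      using Add_Comp[OF z Comp_Mor[OF S(3,1)] Comp_Mor[OF S(4,2)]] S_eqs(5) Id_Comp[OF z]
        Comp_assoc[OF z S(3,1)] Comp_assoc[OF z S(4,2)] by simp
    have "\<rho> \<cdot> ((e \<cdot> k) \<cdot> u) = \<rho> \<cdot> ((e \<cdot> k) \<cdot> v)" "\<pi> \<cdot> ((e \<cdot> k) \<cdot> u) = \<pi> \<cdot> ((e \<cdot> k) \<cdot> v)"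
      using uv(3,4) Comp_assoc[OF uv(1) ek S(3)] Comp_assoc[OF uv(2) ek S(3)]
        Comp_assoc[OF uv(1) ek S(4)] Comp_assoc[OF uv(2) ek S(4)] by simp_all
    then have "(e \<cdot> k) \<cdot> u = (e \<cdot> k) \<cdot> v"
      using split[OF Comp_Mor[OF uv(1) ek]] split[OF Comp_Mor[OF uv(2) ek]] by simp
    then have e_eq: "e \<cdot> (k \<cdot> u) = e \<cdot> (k \<cdot> v)"
      using Comp_assoc[OF uv(1) kt(1) t(1)] Comp_assoc[OF uv(2) kt(1) t(1)] by simp
    have "\<beta> \<cdot> (k \<cdot> u) = \<beta> \<cdot> (k \<cdot> v)"
      using comp_reduce[OF kt(2) kt(1) t(2)] uv(1,2) Zero_Comp o(1) by metis
    then have "k \<cdot> u = k \<cdot> v"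
      using pullback_unique[OF pb t(1,2) Comp_Mor[OF uv(1) kt(1)] Comp_Mor[OF uv(2) kt(1)] e_eq] by simp
    then show "u = v" using kernel_mono[OF k kt(1) uv(1,2)] by simp
  qed
  then show ?thesis by blast
qed

text \<open>Let \<open>x\<close> kill the kernel of \<open>q\<close>. Then \<open>x \<cdot> p\<close> kills the kernel of \<open>q \<cdot> p\<close> and so equals
  \<open>y \<cdot> q \<cdot> p\<close> for some \<open>y\<close>. As \<open>p\<close> need not be epi, \<open>y \<cdot> q = x\<close> is checked after the epimorphism
  \<open>e\<close>, the pullback of \<open>q \<cdot> p\<close> along \<open>q\<close>: there \<open>q \<cdot> e = q \<cdot> (p \<cdot> r)\<close>, and \<open>x\<close> cannot tell \<open>e\<close>
  from \<open>p \<cdot> r\<close>.\<close>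

lemma is_cokernel_right_factor:
  assumes p: "p \<in> Mor C A B" and q: "q \<in> Mor C B D" and qp: "semi_stable_cokernel C (q \<cdot> p)"
  shows "is_cokernel C q"
proof -
  have qpt: "q \<cdot> p \<in> Mor C A D" using Comp_Mor[OF p q] .
  have qpc: "is_cokernel C (q \<cdot> p)" using semi_stable_cokernel_is_cokernel[OF qp] .
  obtain k where k: "is_kernel_of C k q"
    using kernel_if_pullbacks[OF q ex_pullback_of_right_factor[OF p q qp]] .
  obtain K where kt: "k \<in> Mor C K B" "q \<cdot> k = Zero C K D"
    using is_kernel_of_typing[OF k] q by (auto simp: Mor_iff)
  obtain m where m: "is_kernel_of C m (q \<cdot> p)" using semi_stable_cokernel_has_kernel[OF qp] .
  obtain M where mt: "m \<in> Mor C M A" "(q \<cdot> p) \<cdot> m = Zero C M D"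
    using is_kernel_of_typing[OF m] qpt by (auto simp: Mor_iff)
  obtain e r P where t: "e \<in> Mor C P B" "r \<in> Mor C P A" "(q \<cdot> p) \<cdot> r = q \<cdot> e"
      and e: "semi_stable_cokernel C e"
    using semi_stable_cokernel_ex_pullback[OF qp qpt q] by blast
  have "is_cokernel_of C q k"
  proof (rule is_cokernel_of_intro[OF kt(1) q kt(2)])
    fix X x assume x: "x \<in> Mor C B X" "x \<cdot> k = Zero C K X"
    have o: "M \<in> Obj C" "B \<in> Obj C" "X \<in> Obj C" using Mor_Obj mt q x by blast+
    have zM: "Zero C M B \<in> Mor C M B" using Zero_Mor o by blast
    have "q \<cdot> (p \<cdot> m) = q \<cdot> Zero C M B"
      using Comp_assoc[OF mt(1) p q] mt(2) Comp_Zero[OF q o(1)] by simp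
    then have "x \<cdot> (p \<cdot> m) = x \<cdot> Zero C M B"
      using comp_eq_if_kills_kernel[OF k kt(1) q x Comp_Mor[OF mt(1) p] zM] by simp
    then have "(x \<cdot> p) \<cdot> m = Zero C M X"
      using Comp_assoc[OF mt(1) p x(1)] Comp_Zero[OF x(1) o(1)] by simp
    then obtain y where y: "y \<in> Mor C D X" "y \<cdot> (q \<cdot> p) = x \<cdot> p"
      using cokernel_factor[OF cokernel_of_kernel[OF qpc m] mt(1) qpt Comp_Mor[OF p x(1)]] by metis
    have "q \<cdot> (p \<cdot> r) = q \<cdot> e" using t(3) Comp_assoc[OF t(2) p q] by simp
    then have "x \<cdot> (p \<cdot> r) = x \<cdot> e"
      using comp_eq_if_kills_kernel[OF k kt(1) q x Comp_Mor[OF t(2) p] t(1)] by simp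
    moreover have "(y \<cdot> q) \<cdot> e = x \<cdot> (p \<cdot> r)"
      using Comp_assoc[OF t(1) q y(1)] t(3) Comp_assoc[OF t(2) qpt y(1)] y(2) Comp_assoc[OF t(2) p x(1)]
      by simp
    ultimately have "y \<cdot> q = x"
      using cokernel_epi[OF semi_stable_cokernel_is_cokernel[OF e] t(1) Comp_Mor[OF q y(1)] x(1)] by simp
    then show "\<exists>y \<in> Mor C D X. y \<cdot> q = x" using y(1) by blast
  next
    fix X u v assume uv: "u \<in> Mor C D X" "v \<in> Mor C D X" "u \<cdot> q = v \<cdot> q"
    then have "u \<cdot> (q \<cdot> p) = v \<cdot> (q \<cdot> p)" using Comp_assoc[OF p q] by metis
    then show "u = v" using cokernel_epi[OF qpc qpt uv(1,2)] by simp
  qed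
  then show ?thesis unfolding is_cokernel_def by blast
qed

text \<open>The pullback \<open>q'\<close> of \<open>q\<close> is again a right-hand factor of an \<open>ssc\<close>, namely of the pullback of
  \<open>q \<cdot> p\<close>, so it is a cokernel for the same reason as \<open>q\<close>.\<close>

lemma semi_stable_cokernel_right_factor:
  assumes p: "p \<in> Mor C A B" and q: "q \<in> Mor C B D" and qp: "semi_stable_cokernel C (q \<cdot> p)"
  shows "semi_stable_cokernel C q"
  unfolding semi_stable_cokernel_def
proof (intro conjI ballI impI)
  show "is_cokernel C q" using is_cokernel_right_factor[OF p q qp] .
  fix h assume "h \<in> Arr C" "Cod C h = Cod C q"
  then have h: "h \<in> Mor C (Dom C h) D" using q by (auto simp: Mor_iff)
  obtain q' g where pb: "is_pullback C q h q' g" using ex_pullback_of_right_factor[OF p q qp h] by blast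
  obtain P where t: "q' \<in> Mor C P (Dom C h)" "g \<in> Mor C P B"
    using is_pullback_typing[OF pb] q h by (auto simp: Mor_iff)
  obtain e f Q where t': "e \<in> Mor C Q (Dom C h)" "f \<in> Mor C Q A" "(q \<cdot> p) \<cdot> f = h \<cdot> e"
      and e: "semi_stable_cokernel C e"
    using semi_stable_cokernel_ex_pullback[OF qp Comp_Mor[OF p q] h] by blast
  have "q \<cdot> (p \<cdot> f) = h \<cdot> e" using t'(3) Comp_assoc[OF t'(2) p q] by simp
  then obtain u where u: "u \<in> Mor C Q P" "q' \<cdot> u = e"
    using pullback_factor[OF pb t t'(1) Comp_Mor[OF t'(2) p]] by metis
  have "is_cokernel C q'" using is_cokernel_right_factor[OF u(1) t(1)] u(2) e by simp
  then show "\<exists>q' g. is_pullback C q h q' g \<and> is_cokernel C q'" using pb by blast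
qed

lemma semi_stable_kernel_left_factor:
  assumes "f \<in> Mor C A B" "g \<in> Mor C B D" "semi_stable_kernel C (g \<cdot> f)"
  shows "semi_stable_kernel C f"
  using wic_additive_category.semi_stable_cokernel_right_factor[OF wic_additive_category_op_cat, of g D B f A]
    assms by simp

section \<open>The exact structure\<close>

lemma deflation_stable_pullback:
  assumes "deflation (stable_exact_sequences C) d" and pb: "is_pullback C d h d' g"
  shows "deflation (stable_exact_sequences C) d'"
proof -
  obtain i where d: "semi_stable_cokernel C d" and i: "is_kernel_of C i d" "semi_stable_kernel C i"
    using assms(1) by (auto simp: deflation_stable_iff)
  obtain i' where i': "is_kernel_of C i' d'" "g \<cdot> i' = i" using kernel_of_pullback[OF pb i(1)] .
  obtain A P B where "i' \<in> Mor C A P" "g \<in> Mor C P B"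
    using is_kernel_of_typing[OF i'(1)] is_pullback_typing[OF pb] by (auto simp: Mor_iff)
  then have "semi_stable_kernel C i'" using semi_stable_kernel_left_factor i i' by blast
  then show ?thesis using semi_stable_cokernel_pullback[OF d pb] i' by (auto simp: deflation_stable_iff)
qed

text \<open>With the notation of the introduction, \<open>f\<close>, \<open>w\<close> and \<open>g\<close> below are \<open>(m, r)\<close>, \<open>1 \<oplus> j\<close> and \<open>(1, p)\<close>.\<close>

lemma deflation_stable_comp:
  assumes p: "deflation (stable_exact_sequences C) p" and q: "deflation (stable_exact_sequences C) q"
    and pq: "Cod C p = Dom C q"
  shows "deflation (stable_exact_sequences C) (q \<cdot> p)"
proof -
  obtain i where p': "semi_stable_cokernel C p" and i: "is_kernel_of C i p" "semi_stable_kernel C i"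
    using p by (auto simp: deflation_stable_iff)
  obtain j where q': "semi_stable_cokernel C q" and j: "is_kernel_of C j q" "semi_stable_kernel C j"
    using q by (auto simp: deflation_stable_iff)
  obtain I A B where pt: "p \<in> Mor C A B" and it: "i \<in> Mor C I A" using is_kernel_of_typing[OF i(1)] by blast
  obtain J D where qt: "q \<in> Mor C B D" and jt: "j \<in> Mor C J B"
    using is_kernel_of_typing[OF j(1)] pt pq by (auto simp: Mor_iff)
  obtain r m K where pb: "is_pullback C p j r m" and t: "r \<in> Mor C K J" "m \<in> Mor C K A"
      "p \<cdot> m = j \<cdot> r" and r: "semi_stable_cokernel C r"
    using semi_stable_cokernel_ex_pullback[OF p' pt jt] by blast
  have m: "is_kernel_of C m (q \<cdot> p)" using kernel_of_comp[OF qt j(1) pt pb] .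
  obtain a where a: "is_kernel_of C a r" "m \<cdot> a = i" using kernel_of_pullback[OF pb i(1)] .
  have at: "a \<in> Mor C I K" using is_kernel_of_typing[OF a(1)] t a(2) it by (auto simp: Mor_iff)
  have ra: "is_cokernel_of C r a"
    using cokernel_of_kernel[OF semi_stable_cokernel_is_cokernel[OF r] a(1)] .
  have o: "A \<in> Obj C" "J \<in> Obj C" "B \<in> Obj C" using Mor_Obj pt jt by blast+
  obtain S \<iota> \<kappa> \<pi> \<rho> where S: "is_biproduct C A J S \<iota> \<kappa> \<pi> \<rho>" using ex_biproduct[OF o(1,2)] by blast
  obtain S' \<iota>' \<kappa>' \<pi>' \<rho>' where S': "is_biproduct C A B S' \<iota>' \<kappa>' \<pi>' \<rho>'"
    using ex_biproduct[OF o(1,3)] by blast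
  have St: "\<iota> \<in> Mor C A S" "\<kappa> \<in> Mor C J S" "\<pi> \<in> Mor C S A" "\<rho> \<in> Mor C S J"
    and eqs: "\<pi> \<cdot> \<iota> = Id C A" "\<rho> \<cdot> \<kappa> = Id C J" "\<pi> \<cdot> \<kappa> = Zero C J A" "\<rho> \<cdot> \<iota> = Zero C A J"
    and St': "\<iota>' \<in> Mor C A S'" "\<kappa>' \<in> Mor C B S'"
    using S S' by (auto simp: is_biproduct_def)
  define f where "f = Add C (\<iota> \<cdot> m) (\<kappa> \<cdot> r)"
  define w where "w = Add C (\<iota>' \<cdot> \<pi>) (\<kappa>' \<cdot> (j \<cdot> \<rho>))"
  define g where "g = Add C \<iota>' (\<kappa>' \<cdot> p)"
  have \<iota>m: "\<iota> \<cdot> m \<in> Mor C K S" and \<kappa>r: "\<kappa> \<cdot> r \<in> Mor C K S" using Comp_Mor t St by blast+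
  have \<iota>\<pi>: "\<iota>' \<cdot> \<pi> \<in> Mor C S S'" and j\<rho>: "j \<cdot> \<rho> \<in> Mor C S B" using Comp_Mor St St' jt by blast+
  have \<kappa>j\<rho>: "\<kappa>' \<cdot> (j \<cdot> \<rho>) \<in> Mor C S S'" and \<kappa>p: "\<kappa>' \<cdot> p \<in> Mor C A S'"
    using Comp_Mor j\<rho> St' pt by blast+
  have f: "f \<in> Mor C K S" unfolding f_def using Add_Mor[OF \<iota>m \<kappa>r] .
  have w: "w \<in> Mor C S S'" unfolding w_def using Add_Mor[OF \<iota>\<pi> \<kappa>j\<rho>] .
  have g: "g \<in> Mor C A S'" unfolding g_def using Add_Mor[OF St'(1) \<kappa>p] .
  have "semi_stable_kernel C f"
    unfolding f_def using semi_stable_kernel_pairing[OF i(2) it t(2) ra at t(1) a(2) S] .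
  moreover have "semi_stable_kernel C w"
    unfolding w_def using semi_stable_kernel_direct_sum[OF j(2) jt S S'] .
  ultimately have wf: "semi_stable_kernel C (w \<cdot> f)" using semi_stable_kernel_comp f w by blast
  have K: "K \<in> Obj C" using Mor_Obj t by blast
  have "\<pi> \<cdot> f = m"
    unfolding f_def using Comp_Add[OF \<iota>m \<kappa>r St(3)] comp_reduce[OF eqs(1) St(1,3) t(2)]
      comp_reduce[OF eqs(3) St(2,3) t(1)] Id_Comp[OF t(2)] Zero_Comp[OF t(1) o(1)] Add_Zero[OF t(2)]
    by simp
  moreover have "\<rho> \<cdot> f = r"
    unfolding f_def using Comp_Add[OF \<iota>m \<kappa>r St(4)] comp_reduce[OF eqs(4) St(1,4) t(2)]
      comp_reduce[OF eqs(2) St(2,4) t(1)] Id_Comp[OF t(1)] Zero_Comp[OF t(2) o(2)] Zero_Add[OF t(1)]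
    by simp
  ultimately have "w \<cdot> f = Add C (\<iota>' \<cdot> m) (\<kappa>' \<cdot> (j \<cdot> r))"
    unfolding w_def using Add_Comp[OF f \<iota>\<pi> \<kappa>j\<rho>] Comp_assoc[OF f St(3) St'(1)]
      Comp_assoc[OF f j\<rho> St'(2)] Comp_assoc[OF f St(4) jt] by simp
  also have "\<dots> = g \<cdot> m"
    unfolding g_def using Add_Comp[OF t(2) St'(1) \<kappa>p] Comp_assoc[OF t(2) pt St'(2)] t(3) by simp
  finally have "semi_stable_kernel C m" using semi_stable_kernel_left_factor[OF t(2) g] wf by simp
  then show ?thesis using m semi_stable_cokernel_comp[OF p' pt q' qt] by (auto simp: deflation_stable_iff)
qed

lemma inflation_stable_pushout:
  assumes "inflation (stable_exact_sequences C) i" "is_pushout C i f i' g"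
  shows "inflation (stable_exact_sequences C) i'"
  using wic_additive_category.deflation_stable_pullback[OF wic_additive_category_op_cat, of i f i' g] assms
  by (simp add: deflation_stable_op_cat)

theorem exact_structure_stable: "exact_structure C (stable_exact_sequences C)"
proof
  show "stable_exact_sequences C \<subseteq> short_exact_sequences C" by (auto simp: stable_exact_sequences_def)
next
  fix d h assume "deflation (stable_exact_sequences C) d" "h \<in> Arr C" "Cod C h = Cod C d"
  then show "\<exists>d' g. is_pullback C d h d' g"
    unfolding deflation_def stable_exact_sequences_def semi_stable_cokernel_def by blast
next
  fix i f assume "inflation (stable_exact_sequences C) i" "f \<in> Arr C" "Dom C f = Dom C i"
  then show "\<exists>i' g. is_pushout C i f i' g"
    unfolding inflation_def stable_exact_sequences_def semi_stable_kernel_def by blast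
qed (fact deflation_stable_Id_zero deflation_stable_comp deflation_stable_pullback
    inflation_stable_pushout)+

end

section \<open>Maximality\<close>

lemma conflation_is_stable:
  assumes "exact_structure C E" and c: "(i, d) \<in> E"
  shows "(i, d) \<in> stable_exact_sequences C"
proof -
  interpret exact_structure C E by fact
  have defl: "deflation E d" and infl: "inflation E i" using c by (auto simp: deflation_def inflation_def)
  have coker: "is_cokernel C d'" if "deflation E d'" for d'
    using that conflations by (auto simp: deflation_def short_exact_sequences_def is_cokernel_def)
  have ker: "is_kernel C i'" if "inflation E i'" for i'
    using that conflations by (auto simp: inflation_def short_exact_sequences_def is_kernel_def)
  have "semi_stable_cokernel C d"
    unfolding semi_stable_cokernel_def using coker defl E2_ex E2 by blast
  moreover have "semi_stable_kernel C i"
    unfolding semi_stable_kernel_def using ker infl E2op_ex E2op by blast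
  ultimately show ?thesis using c conflations by (auto simp: stable_exact_sequences_def)
qed

theorem theorem3p5:
  fixes C :: "('o, 'm, 'z) preadd_cat_scheme"
  assumes "additive_category C"
    and "weakly_idempotent_complete C"
  shows "exact_structure C (stable_exact_sequences C) \<and>
    (\<forall>E. exact_structure C E \<longrightarrow> E \<subseteq> stable_exact_sequences C)"
proof (intro conjI allI impI)
  have "wic_additive_category C"
    using assms by (simp add: wic_additive_category_def wic_additive_category_axioms_def)
  then show "exact_structure C (stable_exact_sequences C)"
    by (rule wic_additive_category.exact_structure_stable)
next
  fix E assume "exact_structure C E"
  then show "E \<subseteq> stable_exact_sequences C" using conflation_is_stable by fast
qed

end
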